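(* Let $G=(V,E)$ be a finite connected simple graph and let $2\le n\le |V|$. Consider the Markov chain on $\mathrm{Subtrees}(G,n)$ with the following transition. Given $X_0=t$, pick a random oriented edge $(\mathbf u,\mathbf u')$, where $\mathbf u$ is uniform among the vertices of $t$ and, conditionally on $\mathbf u$, $\mathbf u'$ is uniform among the neighbours of $\mathbf u$ in $G$. (1) If $\mathbf u'\notin V(t)$, pick a second oriented edge $(\mathbf v,\mathbf v')$, independent of and with the same law as $(\mathbf u,\mathbf u')$. If $\{\mathbf v,\mathbf v'\}\in E(t)$, $\mathbf v'$ is a leaf of $t$, and removing the vertex $\mathbf v'$ together with the edge $\{\mathbf v,\mathbf v'\}$ from $t\cup\{\mathbf u,\mathbf u'\}$ produces a tree $t'$, set $X_1=t'$; otherwise set $X_1=t$. (2) If $\mathbf u'\in V(t)$, then adding the edge $\{\mathbf u,\mathbf u'\}$ to $t$ creates a cycle $c$ (if $\{\mathbf u,\mathbf u'\}$ is already an edge of $t$, $c$ is regarded as reduced to this single edge and $X_1=t$). Pick an edge $e$ of $c$ according to the distribution $p_c$, and let $X_1$ be the tree obtained by adding $\{\mathbf u,\mathbf u'\}$ to $t$ and then removing $e$. This chain is irreducible, aperiodic, and reversible with respect to the uniform distribution on $\mathrm{Subtrees}(G,n)$; hence it is ergodic and its unique invariant distribution is the uniform distribution on $\mathrm{Subtrees}(G,n)$.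
   Context: $\mathrm{Subtrees}(G,n)$ denotes the set of subgraphs of $G$ which are trees with exactly $n$ vertices. A leaf of a tree is a vertex of degree 1 in the tree. For a simple cycle $c=(c_0,\dots,c_{m-1})$ of $G$ (where $c_i$ and $c_{i+1 \bmod m}$ are neighbours), $p_c$ is the probability distribution on the unoriented edges of $c$ given by $$p_c(\{c_i,c_{i+1 \bmod m}\})=\alpha_c\left(\frac1{\deg_G(c_i)}+\frac1{\deg_G(c_{i+1 \bmod m})}\right),$$ where $\alpha_c$ is the normalizing constant. *)

theory Defs
  imports "HOL-Probability.Probability"
begin

section \<open>Undirected simple graphs and their subtrees\<close>

datatype 'a ugraph = UGraph (verts: "'a set") (edges: "'a set set")

definition simple_graph :: "'a ugraph \<Rightarrow> bool" where
  "simple_graph G \<longleftrightarrow>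
     (\<forall>e\<in>edges G. \<exists>u v. u \<in> verts G \<and> v \<in> verts G \<and> u \<noteq> v \<and> e = {u, v})"

definition neighbours :: "'a ugraph \<Rightarrow> 'a \<Rightarrow> 'a set" where
  "neighbours G v = {w. {v, w} \<in> edges G}"

definition degree :: "'a ugraph \<Rightarrow> 'a \<Rightarrow> nat" where
  "degree G v = card (neighbours G v)"

definition is_walk :: "'a ugraph \<Rightarrow> 'a list \<Rightarrow> bool" where
  "is_walk G p \<longleftrightarrow> p \<noteq> [] \<and> set p \<subseteq> verts G \<and>
     (\<forall>i. Suc i < length p \<longrightarrow> {p ! i, p ! Suc i} \<in> edges G)"

definition connected_graph :: "'a ugraph \<Rightarrow> bool" where
  "connected_graph G \<longleftrightarrow> verts G \<noteq> {} \<and>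
     (\<forall>u\<in>verts G. \<forall>v\<in>verts G. \<exists>p. is_walk G p \<and> hd p = u \<and> last p = v)"

definition cycle_edges :: "'a list \<Rightarrow> 'a set set" where
  "cycle_edges c = {{c ! i, c ! (Suc i mod length c)} | i. i < length c}"

definition is_cycle :: "'a ugraph \<Rightarrow> 'a list \<Rightarrow> bool" where
  "is_cycle G c \<longleftrightarrow> 3 \<le> length c \<and> distinct c \<and> set c \<subseteq> verts G \<and> cycle_edges c \<subseteq> edges G"

definition is_tree :: "'a ugraph \<Rightarrow> bool" where
  "is_tree t \<longleftrightarrow> simple_graph t \<and> connected_graph t \<and> (\<nexists>c. is_cycle t c)"

definition is_leaf :: "'a ugraph \<Rightarrow> 'a \<Rightarrow> bool" where
  "is_leaf t v \<longleftrightarrow> v \<in> verts t \<and> degree t v = 1"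

definition is_subgraph :: "'a ugraph \<Rightarrow> 'a ugraph \<Rightarrow> bool" where
  "is_subgraph H G \<longleftrightarrow> simple_graph H \<and> verts H \<subseteq> verts G \<and> edges H \<subseteq> edges G"

definition Subtrees :: "'a ugraph \<Rightarrow> nat \<Rightarrow> 'a ugraph set" where
  "Subtrees G n = {t. is_subgraph t G \<and> is_tree t \<and> card (verts t) = n}"

definition add_edge :: "'a ugraph \<Rightarrow> 'a \<Rightarrow> 'a \<Rightarrow> 'a ugraph" where
  "add_edge t u u' = UGraph (verts t \<union> {u, u'}) (insert {u, u'} (edges t))"

definition remove_edge :: "'a ugraph \<Rightarrow> 'a set \<Rightarrow> 'a ugraph" where
  "remove_edge t e = UGraph (verts t) (edges t - {e})"

text \<open>Only the named edge is removed along with the vertex; if another edge at \<open>v'\<close> is left over,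
  the result is not a \<^const>\<open>simple_graph\<close>, hence not a tree.\<close>
definition remove_leaf :: "'a ugraph \<Rightarrow> 'a \<Rightarrow> 'a \<Rightarrow> 'a ugraph" where
  "remove_leaf t v v' = UGraph (verts t - {v'}) (edges t - {{v, v'}})"

section \<open>The transition kernel\<close>

text \<open>For an edge \<open>e = {x, y}\<close> this is \<open>1 / deg x + 1 / deg y\<close>.\<close>
definition edge_weight :: "'a ugraph \<Rightarrow> 'a set \<Rightarrow> real" where
  "edge_weight G e = (\<Sum>x\<in>e. 1 / real (degree G x))"

definition cycle_const :: "'a ugraph \<Rightarrow> 'a list \<Rightarrow> real" where
  "cycle_const G c = 1 / (\<Sum>e\<in>cycle_edges c. edge_weight G e)"

definition cycle_pmf :: "'a ugraph \<Rightarrow> 'a list \<Rightarrow> 'a set pmf" where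
  "cycle_pmf G c =
     embed_pmf (\<lambda>e. if e \<in> cycle_edges c then cycle_const G c * edge_weight G e else 0)"

text \<open>The cycle created by a new edge between two vertices of a tree is unique up to rotation and
  reversal of the vertex list, and \<^const>\<open>cycle_pmf\<close> depends only on the set of edges of the
  cycle, so the choice is immaterial.\<close>
definition created_cycle :: "'a ugraph \<Rightarrow> 'a \<Rightarrow> 'a \<Rightarrow> 'a list" where
  "created_cycle t u u' = (SOME c. is_cycle (add_edge t u u') c)"

definition random_oriented_edge :: "'a ugraph \<Rightarrow> 'a ugraph \<Rightarrow> ('a \<times> 'a) pmf" where
  "random_oriented_edge G t = do {
     u \<leftarrow> pmf_of_set (verts t);
     u' \<leftarrow> pmf_of_set (neighbours G u);
     return_pmf (u, u')
   }"

definition subtree_step :: "'a ugraph \<Rightarrow> 'a ugraph \<Rightarrow> 'a ugraph pmf" where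
  "subtree_step G t = do {
     (u, u') \<leftarrow> random_oriented_edge G t;
     if u' \<notin> verts t then do {
       (v, v') \<leftarrow> random_oriented_edge G t;
       let t' = remove_leaf (add_edge t u u') v v';
       return_pmf (if {v, v'} \<in> edges t \<and> is_leaf t v' \<and> is_tree t' then t' else t)
     }
     else if {u, u'} \<in> edges t then return_pmf t
     else do {
       e \<leftarrow> cycle_pmf G (created_cycle t u u');
       return_pmf (remove_edge (add_edge t u u') e)
     }
   }"

section \<open>Markov chains given by a kernel \<open>K\<close> on a state space \<open>S\<close>\<close>

definition kernel_on :: "'s set \<Rightarrow> ('s \<Rightarrow> 's pmf) \<Rightarrow> bool" where
  "kernel_on S K \<longleftrightarrow> (\<forall>x\<in>S. set_pmf (K x) \<subseteq> S)"

primrec n_step :: "('s \<Rightarrow> 's pmf) \<Rightarrow> nat \<Rightarrow> 's \<Rightarrow> 's pmf" where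
  "n_step K 0 x = return_pmf x"
| "n_step K (Suc k) x = bind_pmf (n_step K k x) K"

definition irreducible_chain :: "'s set \<Rightarrow> ('s \<Rightarrow> 's pmf) \<Rightarrow> bool" where
  "irreducible_chain S K \<longleftrightarrow> (\<forall>x\<in>S. \<forall>y\<in>S. \<exists>k. pmf (n_step K k x) y > 0)"

definition period :: "('s \<Rightarrow> 's pmf) \<Rightarrow> 's \<Rightarrow> nat" where
  "period K x = Gcd {k. k > 0 \<and> pmf (n_step K k x) x > 0}"

definition aperiodic_chain :: "'s set \<Rightarrow> ('s \<Rightarrow> 's pmf) \<Rightarrow> bool" where
  "aperiodic_chain S K \<longleftrightarrow> (\<forall>x\<in>S. period K x = 1)"

definition reversible_wrt :: "'s set \<Rightarrow> ('s \<Rightarrow> 's pmf) \<Rightarrow> 's pmf \<Rightarrow> bool" where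
  "reversible_wrt S K \<pi> \<longleftrightarrow>
     (\<forall>x\<in>S. \<forall>y\<in>S. pmf \<pi> x * pmf (K x) y = pmf \<pi> y * pmf (K y) x)"

definition invariant_distribution :: "'s set \<Rightarrow> ('s \<Rightarrow> 's pmf) \<Rightarrow> 's pmf \<Rightarrow> bool" where
  "invariant_distribution S K \<pi> \<longleftrightarrow> set_pmf \<pi> \<subseteq> S \<and> bind_pmf \<pi> K = \<pi>"

text \<open>Ergodicity: the law at time \<open>k\<close> converges to a distribution on \<open>S\<close> that does not depend on
  the starting state.\<close>
definition ergodic_chain :: "'s set \<Rightarrow> ('s \<Rightarrow> 's pmf) \<Rightarrow> bool" where
  "ergodic_chain S K \<longleftrightarrow> (\<exists>\<pi>. set_pmf \<pi> \<subseteq> S \<and>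
     (\<forall>x\<in>S. \<forall>y\<in>S. (\<lambda>k. pmf (n_step K k x) y) \<longlonglongrightarrow> pmf \<pi> y))"

end

theory Submission
  imports Defs
begin

text \<open>
  The chain holds at every state with positive probability, because the first oriented edge may
  be an edge of the current tree. For a finite chain that holds everywhere, irreducibility
  already makes some power of the kernel strictly positive, and a strictly positive kernel
  contracts the \<open>l1\<close> distance between distributions. This gives convergence and uniqueness of
  the invariant distribution (\<open>ergodic_chainI\<close>, \<open>invariant_unique\<close>), so that what remains is to
  show that the kernel preserves the set of subtrees, that it is symmetric, and that it is
  irreducible.

  Symmetry (\<open>subtree_step_sym\<close>). A transition \<open>t \<rightarrow> t'\<close> with \<open>t \<noteq> t'\<close> is produced by a pair \<open>x =
  (u, u')\<close>, \<open>y = (v, v')\<close> of oriented edges: \<open>x\<close> is added and \<open>y\<close> is removed. For a leaf move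
  both oriented edges are drawn, with probability \<open>1 / (n deg u) * 1 / (n deg v)\<close>. For a cycle
  move \<open>x\<close> is drawn, and the weight \<open>1 / deg v + 1 / deg v'\<close> of the removed edge is split among
  its two orientations, so that the pair contributes \<open>1 / (n deg u) * \<alpha> / deg v\<close>. Either way
  \<open>(x, y)\<close> contributes to \<open>t \<rightarrow> t'\<close> exactly what \<open>(y, x)\<close> contributes to \<open>t' \<rightarrow> t\<close>; for cycle
  moves this uses that \<open>t + uu'\<close> and \<open>t' + vv'\<close> are the same graph, hence have the same created
  cycle and the same constant \<open>\<alpha>\<close>. Summing over all pairs gives the symmetry.

  Irreducibility (\<open>irreducible_Subtrees\<close>). If a tree \<open>A\<close> with fewer than \<open>n\<close> vertices is
  contained in \<open>t\<close> and \<open>ab\<close> is an edge of \<open>G\<close> leaving \<open>A\<close>, then a single step leads from \<open>t\<close> to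
  a tree containing \<open>A + ab\<close> (\<open>extend_common_subtree\<close>): if \<open>b\<close> is not in \<open>t\<close>, attach \<open>b\<close> and
  drop a leaf of \<open>t\<close> outside \<open>A\<close>; otherwise, if \<open>ab\<close> is not in \<open>t\<close>, add \<open>ab\<close> and remove an edge
  of the created cycle that is not in the tree \<open>A + ab\<close>. With \<open>A\<close> a single vertex, this moves
  \<open>t\<close> along a walk of \<open>G\<close> until it meets a target \<open>s\<close>; from then on the common subtree of the
  current state and \<open>s\<close> is enlarged edge by edge along \<open>s\<close> until it is all of \<open>s\<close>.

  The facts about trees that this needs all come from growing a subtree along edges that leave
  its vertex set (\<open>connected_spanning_subtree\<close>): a tree has a leaf outside any proper subtree,
  and a connected graph is a tree iff it has one edge less than vertices, from which it follows
  that an exchange along a cycle yields a tree.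
\<close>

section \<open>Finite chains with positive holding probabilities\<close>

lemma pmf_bind_finite:
  assumes "finite A" "set_pmf M \<subseteq> A"
  shows "pmf (bind_pmf M f) y = (\<Sum>x\<in>A. pmf M x * pmf (f x) y)"
proof -
  have "pmf (bind_pmf M f) y = (\<integral>x. pmf (f x) y \<partial>measure_pmf M)"
    by (simp add: pmf_bind)
  also have "\<dots> = (\<Sum>x\<in>A. pmf (f x) y * pmf M x)"
    using assms by (intro integral_measure_pmf_real) auto
  finally show ?thesis by (simp add: mult.commute)
qed

lemma n_step_add: "n_step K (j + k) x = bind_pmf (n_step K j x) (n_step K k)"
proof (induction k)
  case (Suc k)
  then show ?case by (simp add: bind_assoc_pmf)
qed (simp add: bind_return_pmf')

lemma set_n_step_subset:
  assumes "kernel_on S K" "x \<in> S"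
  shows "set_pmf (n_step K k x) \<subseteq> S"
proof (induction k)
  case (Suc k)
  then show ?case using assms by (fastforce simp: kernel_on_def)
qed (use assms in simp)

lemma kernel_on_n_step: "kernel_on S K \<Longrightarrow> kernel_on S (n_step K k)"
  using set_n_step_subset unfolding kernel_on_def by metis

lemma bind_n_step_invariant: "bind_pmf \<pi> K = \<pi> \<Longrightarrow> bind_pmf \<pi> (n_step K k) = \<pi>"
proof (induction k)
  case 0
  have "n_step K 0 = return_pmf" by (intro ext) simp
  then show ?case by (simp add: bind_return_pmf')
next
  case (Suc k)
  then show ?case by (simp flip: bind_assoc_pmf)
qed

definition l1_dist :: "'s set \<Rightarrow> 's pmf \<Rightarrow> 's pmf \<Rightarrow> real" where
  "l1_dist S \<mu> \<nu> = (\<Sum>y\<in>S. \<bar>pmf \<mu> y - pmf \<nu> y\<bar>)"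

text \<open>The differences \<open>f x = pmf \<mu> x - pmf \<nu> x\<close> sum to zero, so subtracting the constant \<open>\<delta>\<close>
  from every entry of the kernel does not change the image of \<open>f\<close>, while the row sums drop from
  \<open>1\<close> to \<open>1 - card S * \<delta>\<close> (Doeblin). With \<open>\<delta> = 0\<close> this says that a kernel never increases the
  distance.\<close>
lemma l1_dist_bind_le:
  assumes S: "finite S" and K: "kernel_on S K"
    and \<delta>: "\<And>x y. x \<in> S \<Longrightarrow> y \<in> S \<Longrightarrow> \<delta> \<le> pmf (K x) y"
    and \<mu>: "set_pmf \<mu> \<subseteq> S" and \<nu>: "set_pmf \<nu> \<subseteq> S"
  shows "l1_dist S (bind_pmf \<mu> K) (bind_pmf \<nu> K) \<le> (1 - real (card S) * \<delta>) * l1_dist S \<mu> \<nu>"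
proof -
  define f where "f x = pmf \<mu> x - pmf \<nu> x" for x
  have f0: "(\<Sum>x\<in>S. f x) = 0"
    using sum_pmf_eq_1[OF S \<mu>] sum_pmf_eq_1[OF S \<nu>] by (simp add: f_def sum_subtractf)
  have row: "(\<Sum>y\<in>S. pmf (K x) y) = 1" if "x \<in> S" for x
    using K that S by (intro sum_pmf_eq_1) (auto simp: kernel_on_def)
  have "pmf (bind_pmf \<mu> K) y - pmf (bind_pmf \<nu> K) y = (\<Sum>x\<in>S. f x * (pmf (K x) y - \<delta>))" for y
    using f0 by (simp add: pmf_bind_finite[OF S \<mu>] pmf_bind_finite[OF S \<nu>] f_def algebra_simps
        sum_subtractf sum.distrib flip: sum_distrib_left sum_distrib_right)
  then have "l1_dist S (bind_pmf \<mu> K) (bind_pmf \<nu> K)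
      = (\<Sum>y\<in>S. \<bar>\<Sum>x\<in>S. f x * (pmf (K x) y - \<delta>)\<bar>)"
    by (simp add: l1_dist_def)
  also have "\<dots> \<le> (\<Sum>y\<in>S. \<Sum>x\<in>S. \<bar>f x\<bar> * (pmf (K x) y - \<delta>))"
    using \<delta> by (intro sum_mono order_trans[OF sum_abs]) (auto simp: abs_mult intro!: sum_mono)
  also have "\<dots> = (\<Sum>x\<in>S. \<bar>f x\<bar> * ((\<Sum>y\<in>S. pmf (K x) y) - real (card S) * \<delta>))"
    by (subst sum.swap) (simp add: sum_distrib_left sum_subtractf algebra_simps)
  also have "\<dots> = (1 - real (card S) * \<delta>) * l1_dist S \<mu> \<nu>"
    using row by (simp add: l1_dist_def f_def sum_distrib_left mult.commute)
  finally show ?thesis .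
qed

text \<open>Holding lets a positive transition be prolonged by any number of steps, so a common number of
  steps serves all pairs of states.\<close>
lemma n_step_all_pos:
  assumes S: "finite S" and irr: "irreducible_chain S K"
    and hold: "\<And>x. x \<in> S \<Longrightarrow> pmf (K x) x > 0" and K: "kernel_on S K"
  obtains N where "\<And>x y. x \<in> S \<Longrightarrow> y \<in> S \<Longrightarrow> pmf (n_step K N x) y > 0"
proof -
  have mono: "pmf (n_step K (k + j) x) y > 0" if "pmf (n_step K k x) y > 0" "y \<in> S" for k j x y
  proof (induction j)
    case (Suc j)
    then have "y \<in> set_pmf (n_step K (Suc (k + j)) x)"
      using hold[OF \<open>y \<in> S\<close>] by (auto simp: pmf_positive_iff)
    then show ?case by (simp add: pmf_positive_iff del: n_step.simps)
  qed (use that in simp)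
  obtain k where k: "\<And>x y. x \<in> S \<Longrightarrow> y \<in> S \<Longrightarrow> pmf (n_step K (k x y) x) y > 0"
    using irr unfolding irreducible_chain_def by metis
  \<comment> \<open>the sum bounds every \<open>k x y\<close> from above\<close>
  define N where "N = (\<Sum>(x, y)\<in>S \<times> S. k x y)"
  have "pmf (n_step K N x) y > 0" if "x \<in> S" "y \<in> S" for x y
  proof -
    have "(case (x, y) of (x, y) \<Rightarrow> k x y) \<le> N"
      unfolding N_def using S that by (intro member_le_sum) auto
    then obtain j where "N = k x y + j" by (auto simp: le_iff_add)
    with mono[OF k[OF that]] that show ?thesis by simp
  qed
  then show ?thesis using that by blast
qed

lemma n_step_contraction:
  assumes S: "finite S" "S \<noteq> {}" and K: "kernel_on S K" and irr: "irreducible_chain S K"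
    and hold: "\<And>x. x \<in> S \<Longrightarrow> pmf (K x) x > 0"
  shows "\<exists>N \<rho>. \<rho> < 1 \<and> (\<forall>\<mu> \<nu>. set_pmf \<mu> \<subseteq> S \<longrightarrow> set_pmf \<nu> \<subseteq> S \<longrightarrow>
    l1_dist S (bind_pmf \<mu> (n_step K N)) (bind_pmf \<nu> (n_step K N)) \<le> \<rho> * l1_dist S \<mu> \<nu>)"
proof -
  obtain N where N: "\<And>x y. x \<in> S \<Longrightarrow> y \<in> S \<Longrightarrow> pmf (n_step K N x) y > 0"
    using n_step_all_pos[OF S(1) irr hold K] by blast
  define \<delta> where "\<delta> = Min ((\<lambda>(x, y). pmf (n_step K N x) y) ` (S \<times> S))"
  have "\<delta> > 0" unfolding \<delta>_def using S N by (subst Min_gr_iff) auto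
  have \<delta>: "\<delta> \<le> pmf (n_step K N x) y" if "x \<in> S" "y \<in> S" for x y
    unfolding \<delta>_def using S that by (intro Min_le) auto
  have "1 - real (card S) * \<delta> < 1" using \<open>\<delta> > 0\<close> S by (simp add: card_gt_0_iff)
  then show ?thesis
    using l1_dist_bind_le[OF S(1) kernel_on_n_step[OF K, of N] \<delta>] by blast
qed

lemma le_mult_self_imp_0:
  fixes L \<rho> :: real
  assumes "L \<le> \<rho> * L" "0 \<le> L" "\<rho> < 1"
  shows "L = 0"
proof (rule ccontr)
  assume "L \<noteq> 0"
  then have "\<rho> * L < 1 * L" using assms by (intro mult_strict_right_mono) auto
  then show False using assms by simp
qed

lemma invariant_unique:
  assumes "finite S" "S \<noteq> {}" "kernel_on S K" "irreducible_chain S K"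
    and "\<And>x. x \<in> S \<Longrightarrow> pmf (K x) x > 0"
    and \<mu>: "invariant_distribution S K \<mu>" and \<nu>: "invariant_distribution S K \<nu>"
  shows "\<mu> = \<nu>"
proof -
  obtain N \<rho> where "\<rho> < 1" and
    "\<forall>\<mu> \<nu>. set_pmf \<mu> \<subseteq> S \<longrightarrow> set_pmf \<nu> \<subseteq> S \<longrightarrow>
      l1_dist S (bind_pmf \<mu> (n_step K N)) (bind_pmf \<nu> (n_step K N)) \<le> \<rho> * l1_dist S \<mu> \<nu>"
    using n_step_contraction[OF assms(1-5)] by blast
  with \<mu> \<nu> have "l1_dist S \<mu> \<nu> \<le> \<rho> * l1_dist S \<mu> \<nu>"
    unfolding invariant_distribution_def by (metis bind_n_step_invariant)
  moreover have "l1_dist S \<mu> \<nu> \<ge> 0" by (simp add: l1_dist_def sum_nonneg)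
  ultimately have "l1_dist S \<mu> \<nu> = 0"
    using \<open>\<rho> < 1\<close> le_mult_self_imp_0 by blast
  then have "pmf \<mu> y = pmf \<nu> y" if "y \<in> S" for y
    using that assms(1) by (simp add: l1_dist_def sum_nonneg_eq_0_iff)
  moreover have "pmf \<mu> y = 0 \<and> pmf \<nu> y = 0" if "y \<notin> S" for y
    using that \<mu> \<nu> by (auto simp: invariant_distribution_def pmf_eq_0_set_pmf)
  ultimately show ?thesis by (intro pmf_eqI) metis
qed

text \<open>The distance to \<open>\<pi>\<close> decreases, hence has a limit \<open>L \<ge> 0\<close>; contraction over \<open>N\<close> steps gives
  \<open>L \<le> \<rho> * L\<close> with \<open>\<rho> < 1\<close>, so \<open>L = 0\<close>.\<close>
lemma ergodic_chainI:
  assumes S: "finite S" "S \<noteq> {}" and K: "kernel_on S K" and irr: "irreducible_chain S K"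
    and hold: "\<And>x. x \<in> S \<Longrightarrow> pmf (K x) x > 0"
    and \<pi>: "invariant_distribution S K \<pi>"
  shows "ergodic_chain S K"
  unfolding ergodic_chain_def
proof (intro exI conjI ballI)
  show \<pi>S: "set_pmf \<pi> \<subseteq> S" using \<pi> by (simp add: invariant_distribution_def)
  fix x y assume x: "x \<in> S" and y: "y \<in> S"
  obtain N \<rho> where "\<rho> < 1" and N:
    "\<forall>\<mu> \<nu>. set_pmf \<mu> \<subseteq> S \<longrightarrow> set_pmf \<nu> \<subseteq> S \<longrightarrow>
      l1_dist S (bind_pmf \<mu> (n_step K N)) (bind_pmf \<nu> (n_step K N)) \<le> \<rho> * l1_dist S \<mu> \<nu>"
    using n_step_contraction[OF S K irr hold] by blast
  define d where "d k = l1_dist S (n_step K k x) \<pi>" for k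
  note inv = \<pi>[unfolded invariant_distribution_def, THEN conjunct2]
  have d_nonneg: "d k \<ge> 0" for k by (simp add: d_def l1_dist_def sum_nonneg)
  have "d (Suc k) \<le> d k" for k
    using l1_dist_bind_le[OF S(1) K, of 0 "n_step K k x" \<pi>] set_n_step_subset[OF K x] \<pi>S inv
    by (simp add: d_def)
  then have "decseq d" by (simp add: decseq_Suc_iff)
  then obtain L where L: "d \<longlonglongrightarrow> L"
    using decseq_convergent[of d 0] d_nonneg by blast
  have "d (k + N) \<le> \<rho> * d k" for k
    using N[rule_format, OF set_n_step_subset[OF K x, of k] \<pi>S] bind_n_step_invariant[OF inv]
    by (simp add: d_def n_step_add)
  then have "L \<le> \<rho> * L"
    using LIMSEQ_le[OF LIMSEQ_ignore_initial_segment[OF L, of N] tendsto_mult_left[OF L, of \<rho>]]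
    by blast
  moreover have "L \<ge> 0" using LIMSEQ_le_const[OF L] d_nonneg by blast
  ultimately have "L = 0"
    using \<open>\<rho> < 1\<close> le_mult_self_imp_0 by blast
  have "norm (pmf (n_step K k x) y - pmf \<pi> y) \<le> d k" for k
    unfolding d_def l1_dist_def real_norm_def using S y
    by (intro member_le_sum[of y S "\<lambda>y. \<bar>pmf (n_step K k x) y - pmf \<pi> y\<bar>"]) auto
  then have "(\<lambda>k. pmf (n_step K k x) y - pmf \<pi> y) \<longlonglongrightarrow> 0"
    by (intro Lim_null_comparison[OF always_eventually L[unfolded \<open>L = 0\<close>]] allI)
  then show "(\<lambda>k. pmf (n_step K k x) y) \<longlonglongrightarrow> pmf \<pi> y"
    by (simp add: LIM_zero_iff)
qed

lemma aperiodic_chainI: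
  assumes "\<And>x. x \<in> S \<Longrightarrow> pmf (K x) x > 0"
  shows "aperiodic_chain S K"
  unfolding aperiodic_chain_def
proof
  fix x assume "x \<in> S"
  then have "1 \<in> {k. k > 0 \<and> pmf (n_step K k x) x > 0}"
    using assms by (simp add: bind_return_pmf)
  then have "period K x dvd 1" unfolding period_def by (rule Gcd_dvd)
  then show "period K x = 1" by simp
qed

lemma reversible_imp_invariant:
  assumes S: "finite S" and K: "kernel_on S K" and \<pi>: "set_pmf \<pi> \<subseteq> S"
    and rev: "reversible_wrt S K \<pi>"
  shows "invariant_distribution S K \<pi>"
proof -
  have "bind_pmf \<pi> K = \<pi>"
  proof (rule pmf_eqI)
    fix y
    show "pmf (bind_pmf \<pi> K) y = pmf \<pi> y"
    proof (cases "y \<in> S")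
      case True
      have "pmf (bind_pmf \<pi> K) y = (\<Sum>x\<in>S. pmf \<pi> y * pmf (K y) x)"
        using True rev by (auto simp: pmf_bind_finite[OF S \<pi>] reversible_wrt_def intro!: sum.cong)
      also have "\<dots> = pmf \<pi> y"
        using K True S by (simp flip: sum_distrib_left add: sum_pmf_eq_1 kernel_on_def)
      finally show ?thesis .
    next
      case False
      then have "y \<notin> set_pmf (bind_pmf \<pi> K)" "y \<notin> set_pmf \<pi>"
        using K \<pi> by (auto simp: kernel_on_def)
      then show ?thesis unfolding set_pmf_iff by simp
    qed
  qed
  with \<pi> show ?thesis by (simp add: invariant_distribution_def)
qed

definition reachable :: "('s \<Rightarrow> 's pmf) \<Rightarrow> 's \<Rightarrow> 's \<Rightarrow> bool" where
  "reachable K x y \<longleftrightarrow> (\<exists>k. pmf (n_step K k x) y > 0)"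

lemma reachable_refl: "reachable K x x"
  unfolding reachable_def by (intro exI[of _ 0]) simp

lemma reachable_step: "y \<in> set_pmf (K x) \<Longrightarrow> reachable K x y"
  unfolding reachable_def by (intro exI[of _ 1]) (simp add: bind_return_pmf pmf_positive_iff)

lemma reachable_trans:
  assumes "reachable K x y" "reachable K y z"
  shows "reachable K x z"
proof -
  obtain j k where "y \<in> set_pmf (n_step K j x)" "z \<in> set_pmf (n_step K k y)"
    using assms by (auto simp: reachable_def pmf_positive_iff)
  then have "z \<in> set_pmf (n_step K (j + k) x)" by (auto simp: n_step_add)
  then show ?thesis by (auto simp: reachable_def pmf_positive_iff)
qed

section \<open>Walks and cycles\<close>

abbreviation adj :: "'a ugraph \<Rightarrow> ('a \<times> 'a) set" where
  "adj G \<equiv> {(x, y). {x, y} \<in> edges G}"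

lemma simple_graph_edgeD:
  assumes "simple_graph G" "{x, y} \<in> edges G"
  shows "x \<in> verts G" "y \<in> verts G" "x \<noteq> y"
proof -
  obtain u v where "u \<in> verts G" "v \<in> verts G" "u \<noteq> v" "{x, y} = {u, v}"
    using assms unfolding simple_graph_def by blast
  then show "x \<in> verts G" "y \<in> verts G" "x \<noteq> y" by (auto simp: doubleton_eq_iff)
qed

lemma sym_adj_rtrancl: "sym ((adj G)\<^sup>*)"
  by (intro sym_rtrancl) (auto simp: sym_def insert_commute)

lemma is_walk_imp_rtrancl: "is_walk G p \<Longrightarrow> (hd p, last p) \<in> (adj G)\<^sup>*"
proof (induction p)
  case (Cons x p)
  show ?case
  proof (cases "p = []")
    case False
    have "is_walk G p" using Cons.prems False unfolding is_walk_def by force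
    moreover have "{x, hd p} \<in> edges G"
      using Cons.prems False unfolding is_walk_def by (force simp: hd_conv_nth)
    ultimately show ?thesis
      using Cons.IH False by (auto intro: converse_rtrancl_into_rtrancl)
  qed simp
qed (simp add: is_walk_def)

lemma is_walk_snoc:
  assumes "is_walk G p" "{last p, z} \<in> edges G" "z \<in> verts G"
  shows "is_walk G (p @ [z])"
proof -
  have "{(p @ [z]) ! i, (p @ [z]) ! Suc i} \<in> edges G" if "Suc i < length (p @ [z])" for i
  proof (cases "Suc i = length p")
    case True
    then have "p ! i = last p" using assms(1) by (simp add: is_walk_def last_conv_nth flip: True)
    then show ?thesis using True assms(2) by (simp add: nth_append)
  next
    case False
    then show ?thesis using that assms(1) by (simp add: is_walk_def nth_append)
  qed
  then show ?thesis using assms by (simp add: is_walk_def)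
qed

lemma is_walk_prefix:
  assumes "is_walk G (p @ q)" "p \<noteq> []"
  shows "is_walk G p"
proof -
  have "{p ! i, p ! Suc i} \<in> edges G" if "Suc i < length p" for i
    using assms(1) that unfolding is_walk_def by (auto simp: nth_append dest!: spec[of _ i])
  then show ?thesis using assms by (simp add: is_walk_def)
qed

lemma rtrancl_imp_distinct_walk:
  assumes "simple_graph G" "u \<in> verts G" "(u, v) \<in> (adj G)\<^sup>*"
  obtains p where "is_walk G p" "distinct p" "hd p = u" "last p = v"
proof -
  from assms(3) have "\<exists>p. is_walk G p \<and> distinct p \<and> hd p = u \<and> last p = v"
  proof induction
    case base
    show ?case using assms(2) by (intro exI[of _ "[u]"]) (auto simp: is_walk_def)
  next
    case (step y z)
    then obtain p where p: "is_walk G p" "distinct p" "hd p = u" "last p = y" by blast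
    have [simp]: "p \<noteq> []" using p by (simp add: is_walk_def)
    show ?case
    proof (cases "z \<in> set p")
      case True
      then obtain q r where qr: "p = q @ z # r" by (meson split_list)
      then have "is_walk G (q @ [z])" using p is_walk_prefix[of G "q @ [z]" r] by simp
      then show ?thesis using p qr by (intro exI[of _ "q @ [z]"]) (auto simp: hd_append)
    next
      case False
      then show ?thesis
        using p step.hyps is_walk_snoc[OF p(1)] simple_graph_edgeD[OF assms(1)]
        by (intro exI[of _ "p @ [z]"]) auto
    qed
  qed
  then show ?thesis using that by blast
qed

lemma connected_graph_iff:
  assumes "simple_graph G"
  shows "connected_graph G \<longleftrightarrow> verts G \<noteq> {} \<and> (\<forall>u\<in>verts G. \<forall>v\<in>verts G. (u, v) \<in> (adj G)\<^sup>*)"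
proof -
  have "(\<exists>p. is_walk G p \<and> hd p = u \<and> last p = v) \<longleftrightarrow> (u, v) \<in> (adj G)\<^sup>*" (is "?L \<longleftrightarrow> ?R")
    if u: "u \<in> verts G" for u v
  proof
    show "?L \<Longrightarrow> ?R" using is_walk_imp_rtrancl by metis
    show "?R \<Longrightarrow> ?L" by (erule rtrancl_imp_distinct_walk[OF assms u]) blast
  qed
  then show ?thesis unfolding connected_graph_def by (intro conj_cong refl ball_cong)
qed

lemma connected_graphI:
  assumes "simple_graph G" "r \<in> verts G" "\<And>v. v \<in> verts G \<Longrightarrow> (r, v) \<in> (adj G)\<^sup>*"
  shows "connected_graph G"
proof -
  have "(u, v) \<in> (adj G)\<^sup>*" if "u \<in> verts G" "v \<in> verts G" for u v
    using symD[OF sym_adj_rtrancl assms(3)[OF that(1)]] assms(3)[OF that(2)] by (rule rtrancl_trans)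
  then show ?thesis using assms(2) unfolding connected_graph_iff[OF assms(1)] by blast
qed

lemma verts_add_edge [simp]: "verts (add_edge t u v) = verts t \<union> {u, v}"
  and edges_add_edge [simp]: "edges (add_edge t u v) = insert {u, v} (edges t)"
  and verts_remove_edge [simp]: "verts (remove_edge t e) = verts t"
  and edges_remove_edge [simp]: "edges (remove_edge t e) = edges t - {e}"
  and verts_remove_leaf [simp]: "verts (remove_leaf t u v) = verts t - {v}"
  and edges_remove_leaf [simp]: "edges (remove_leaf t u v) = edges t - {{u, v}}"
  by (simp_all add: add_edge_def remove_edge_def remove_leaf_def)

lemma simple_graph_add_edge:
  assumes "simple_graph t" "u \<noteq> v"
  shows "simple_graph (add_edge t u v)"
  unfolding simple_graph_def
proof
  fix e assume "e \<in> edges (add_edge t u v)"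
  then consider "e = {u, v}" | "e \<in> edges t" by auto
  then show "\<exists>x y. x \<in> verts (add_edge t u v) \<and> y \<in> verts (add_edge t u v) \<and> x \<noteq> y \<and> e = {x, y}"
  proof cases
    case 1
    then show ?thesis using assms(2) by (intro exI[of _ u] exI[of _ v]) simp
  next
    case 2
    then obtain x y where "x \<in> verts t" "y \<in> verts t" "x \<noteq> y" "e = {x, y}"
      using assms(1) unfolding simple_graph_def by blast
    then show ?thesis by (intro exI[of _ x] exI[of _ y]) simp
  qed
qed

lemma simple_graph_remove_edge: "simple_graph t \<Longrightarrow> simple_graph (remove_edge t e)"
  unfolding simple_graph_def by auto

lemma connected_graph_add_edge:
  assumes "simple_graph t" "connected_graph t" "u \<in> verts t" "u \<noteq> v"
  shows "connected_graph (add_edge t u v)"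
proof (rule connected_graphI)
  fix w assume w: "w \<in> verts (add_edge t u v)"
  have "(adj t)\<^sup>* \<subseteq> (adj (add_edge t u v))\<^sup>*" by (intro rtrancl_mono) auto
  then have "(u, w) \<in> (adj (add_edge t u v))\<^sup>*" if "w \<in> verts t"
    using assms that by (auto simp: connected_graph_iff)
  moreover have "(u, v) \<in> (adj (add_edge t u v))\<^sup>*" by auto
  ultimately show "(u, w) \<in> (adj (add_edge t u v))\<^sup>*" using w assms by auto
qed (use assms simple_graph_add_edge in simp_all)

text \<open>The successor and the predecessor on a cycle differ because the cycle has length at least 3.
  This is how acyclicity of an enlarged tree is proved: a new vertex with one neighbour
  lies on no cycle.\<close>
lemma cycle_two_neighbours:
  assumes "is_cycle G c" "x \<in> set c"
  obtains y z where "y \<noteq> z" "{x, y} \<in> cycle_edges c" "{x, z} \<in> cycle_edges c"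
proof -
  let ?m = "length c"
  have c: "3 \<le> ?m" "distinct c" using assms by (auto simp: is_cycle_def)
  obtain i where i: "i < ?m" "x = c ! i" using assms(2) by (metis in_set_conv_nth)
  \<comment> \<open>position of the predecessor of \<open>x\<close>\<close>
  define j where "j = (if i = 0 then ?m - 1 else i - 1)"
  have j: "j < ?m" "Suc j mod ?m = i" "j \<noteq> Suc i mod ?m"
    using c i by (auto simp: j_def mod_Suc)
  have "Suc i mod ?m < ?m" using c by (intro mod_less_divisor) linarith
  then have "c ! (Suc i mod ?m) \<noteq> c ! j"
    using c(2) j(1,3) by (simp add: nth_eq_iff_index_eq)
  moreover have "{x, c ! (Suc i mod ?m)} \<in> cycle_edges c"
    using i unfolding cycle_edges_def by blast
  moreover have "{x, c ! j} \<in> cycle_edges c"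
    using i j(1,2) unfolding cycle_edges_def by (auto simp: insert_commute intro!: exI[of _ j])
  ultimately show ?thesis using that by blast
qed

lemma is_cycle_transfer:
  assumes "is_cycle G c" "simple_graph H" "cycle_edges c \<subseteq> edges H"
  shows "is_cycle H c"
proof -
  have "x \<in> verts H" if x: "x \<in> set c" for x
  proof -
    obtain y where "{x, y} \<in> cycle_edges c" using cycle_two_neighbours[OF assms(1) x] by blast
    then have "{x, y} \<in> edges H" using assms(3) by blast
    then show ?thesis by (rule simple_graph_edgeD(1)[OF assms(2)])
  qed
  then show ?thesis using assms by (auto simp: is_cycle_def)
qed

text \<open>A walk without repetitions from \<open>u\<close> to \<open>v\<close> is closed by the new edge; it has at least
  three vertices since \<open>u\<close> and \<open>v\<close> are distinct and not adjacent.\<close>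
lemma connected_add_edge_cycle:
  assumes "simple_graph t" "connected_graph t" "u \<in> verts t" "v \<in> verts t"
    "u \<noteq> v" "{u, v} \<notin> edges t"
  obtains c where "is_cycle (add_edge t u v) c"
proof -
  obtain p where p: "is_walk t p" "distinct p" "hd p = u" "last p = v"
    using assms rtrancl_imp_distinct_walk[of t u v] by (auto simp: connected_graph_iff)
  have [simp]: "p \<noteq> []" using p by (simp add: is_walk_def)
  have step: "{p ! i, p ! Suc i} \<in> edges t" if "Suc i < length p" for i
    using p(1) that by (simp add: is_walk_def)
  have "length p \<noteq> 1" using p(3,4) assms(5) by (auto simp: length_Suc_conv)
  moreover have "length p \<noteq> 2"
    using p(3,4) assms(6) step[of 0] by (auto simp: hd_conv_nth last_conv_nth)
  moreover have "length p \<noteq> 0" by simp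
  ultimately have len: "3 \<le> length p" by linarith
  have "{p ! i, p ! (Suc i mod length p)} \<in> edges (add_edge t u v)" if "i < length p" for i
  proof (cases "Suc i = length p")
    case True
    then have "p ! i = v" "p ! (Suc i mod length p) = u"
      using p(3,4) by (auto simp: hd_conv_nth last_conv_nth simp flip: True)
    then show ?thesis by (simp add: insert_commute)
  next
    case False
    then show ?thesis using that step[of i] by simp
  qed
  then have "is_cycle (add_edge t u v) p"
    using p len by (auto simp: is_cycle_def is_walk_def cycle_edges_def)
  then show ?thesis using that by blast
qed

text \<open>The rest of the cycle is a detour around the removed edge.\<close>
lemma connected_remove_cycle_edge:
  assumes G: "simple_graph G" "connected_graph G" and c: "is_cycle G c" and e: "e \<in> cycle_edges c"
  shows "connected_graph (remove_edge G e)"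
proof -
  let ?m = "length c" and ?R = "(adj (remove_edge G e))\<^sup>*"
  have m: "3 \<le> ?m" "distinct c" "cycle_edges c \<subseteq> edges G" using c by (auto simp: is_cycle_def)
  have less: "k mod ?m < ?m" for k using m by (intro mod_less_divisor) linarith
  obtain i where i: "i < ?m" "e = {c ! i, c ! (Suc i mod ?m)}"
    using e by (auto simp: cycle_edges_def)
  have around: "(c ! (Suc i mod ?m), c ! ((Suc i + k) mod ?m)) \<in> ?R" if "k < ?m" for k
    using that
  proof (induction k)
    case (Suc k)
    define j where "j = (Suc i + k) mod ?m"
    have j: "j < ?m" "(Suc i + Suc k) mod ?m = Suc j mod ?m"
      using less by (auto simp: j_def mod_Suc_eq)
    have "j \<noteq> i"
    proof
      assume "j = i"
      then show False
        using i(1) Suc.prems by (cases "Suc i + k < ?m") (auto simp: j_def le_mod_geq not_less)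
    qed
    have "{c ! j, c ! (Suc j mod ?m)} \<noteq> e"
    proof
      assume "{c ! j, c ! (Suc j mod ?m)} = e"
      then have "c ! j = c ! (Suc i mod ?m) \<and> c ! (Suc j mod ?m) = c ! i"
        using i j(1) \<open>j \<noteq> i\<close> m(2) by (auto simp: doubleton_eq_iff nth_eq_iff_index_eq)
      then have "j = Suc i mod ?m" "Suc j mod ?m = i"
        using i(1) j(1) m(2) less by (auto simp: nth_eq_iff_index_eq)
      then show False using i m by (auto simp: mod_Suc split: if_splits)
    qed
    moreover have "{c ! j, c ! (Suc j mod ?m)} \<in> edges G"
      using j m by (auto simp: cycle_edges_def)
    ultimately have "(c ! j, c ! (Suc j mod ?m)) \<in> adj (remove_edge G e)" by simp
    with Suc show ?case unfolding j(2) by (simp add: j_def rtrancl.rtrancl_into_rtrancl)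
  qed simp
  have "Suc i + (?m - 1) = i + ?m" using m by linarith
  then have "(Suc i + (?m - 1)) mod ?m = i" using i by simp
  moreover have "?m - 1 < ?m" using m by linarith
  ultimately have "(c ! (Suc i mod ?m), c ! i) \<in> ?R" using around by metis
  then have "(x, y) \<in> ?R" if "{x, y} = e" for x y
    using that i sym_adj_rtrancl[of "remove_edge G e"] by (auto simp: doubleton_eq_iff dest: symD)
  then have "adj G \<subseteq> ?R" by auto
  then have "(adj G)\<^sup>* \<subseteq> ?R" by (rule rtrancl_subset_rtrancl)
  then show ?thesis
    using G by (auto simp: connected_graph_iff simple_graph_remove_edge)
qed

section \<open>Growing trees\<close>

lemma cycle_edge_subset:
  assumes "e \<in> cycle_edges c"
  shows "e \<subseteq> set c"
proof -
  obtain i where i: "i < length c" "e = {c ! i, c ! (Suc i mod length c)}"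
    using assms by (auto simp: cycle_edges_def)
  moreover have "Suc i mod length c < length c" using i(1) by (intro mod_less_divisor) linarith
  ultimately show ?thesis by auto
qed

lemma is_subgraph_refl: "simple_graph t \<Longrightarrow> is_subgraph t t"
  by (simp add: is_subgraph_def)

lemma is_subgraph_add_edge:
  assumes "is_subgraph A t" "simple_graph t" "{a, b} \<in> edges t"
  shows "is_subgraph (add_edge A a b) t"
  using assms simple_graph_edgeD[OF assms(2,3)] simple_graph_add_edge[of A a b]
  by (simp add: is_subgraph_def)

lemma finite_edges:
  assumes "simple_graph G" "finite (verts G)"
  shows "finite (edges G)"
proof (rule finite_subset)
  show "edges G \<subseteq> Pow (verts G)" using assms(1) unfolding simple_graph_def by fast
qed (use assms in simp)

lemma connected_exit_edge:
  assumes "simple_graph G" "connected_graph G" "X \<subseteq> verts G" "X \<noteq> {}" "X \<noteq> verts G"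
  obtains a b where "a \<in> X" "b \<notin> X" "{a, b} \<in> edges G"
proof (rule ccontr)
  assume no: "\<not> thesis"
  obtain x y where x: "x \<in> X" and y: "y \<in> verts G" "y \<notin> X" using assms(3-5) by blast
  then have "(x, y) \<in> (adj G)\<^sup>*" using assms(1-3) by (auto simp: connected_graph_iff)
  then have "y \<in> X"
  proof induction
    case (step y z)
    then show ?case using no that[of y z] by auto
  qed (rule x)
  with y show False by simp
qed

lemma is_tree_single: "is_tree (UGraph {v} {})"
proof -
  have "is_walk (UGraph {v} {}) [v]" by (simp add: is_walk_def)
  then have "connected_graph (UGraph {v} {})"
    unfolding connected_graph_def by (auto intro!: exI[of _ "[v]"])
  moreover have False if c: "is_cycle (UGraph {v} {}) c" for c
  proof -
    have "hd c \<in> set c" using c by (cases c) (auto simp: is_cycle_def)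
    with cycle_two_neighbours[OF c] show False using c by (auto simp: is_cycle_def)
  qed
  ultimately show ?thesis by (auto simp: is_tree_def simple_graph_def)
qed

lemma is_tree_add_leaf:
  assumes "is_tree t" "a \<in> verts t" "b \<notin> verts t"
  shows "is_tree (add_edge t a b)"
proof -
  have t: "simple_graph t" "connected_graph t" "\<nexists>c. is_cycle t c"
    using assms by (auto simp: is_tree_def)
  have "a \<noteq> b" using assms by auto
  have b: "{b, x} \<notin> edges t" for x using simple_graph_edgeD(1)[OF t(1)] assms(3) by blast
  have False if c: "is_cycle (add_edge t a b) c" for c
  proof (cases "b \<in> set c")
    case True
    then obtain y z where yz: "y \<noteq> z" "{b, y} \<in> cycle_edges c" "{b, z} \<in> cycle_edges c"
      using cycle_two_neighbours[OF c] by blast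
    then have "{b, y} \<in> edges (add_edge t a b)" "{b, z} \<in> edges (add_edge t a b)"
      using c by (auto simp: is_cycle_def)
    then have "y = a" "z = a" using b by (auto simp: doubleton_eq_iff)
    with yz show False by simp
  next
    case False
    then have "{a, b} \<notin> cycle_edges c"
      using cycle_edge_subset[of "{a, b}" c] by blast
    then have "cycle_edges c \<subseteq> edges t" using c by (auto simp: is_cycle_def)
    with is_cycle_transfer[OF c t(1)] t(3) show False by blast
  qed
  then show ?thesis
    using simple_graph_add_edge[OF t(1) \<open>a \<noteq> b\<close>]
      connected_graph_add_edge[OF t(1,2) assms(2) \<open>a \<noteq> b\<close>]
    unfolding is_tree_def by blast
qed

text \<open>Attach edges leaving the vertex set, one at a time, until all vertices are reached. The
  last attached vertex \<open>v'\<close> is singled out because it becomes a leaf of \<open>t\<close> when \<open>t\<close> is itself a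
  tree.\<close>
lemma connected_spanning_subtree:
  assumes t: "finite (verts t)" "simple_graph t" "connected_graph t"
    and A: "is_tree A" "is_subgraph A t" "verts A \<noteq> verts t"
  shows "\<exists>B v v'. is_tree B \<and> is_subgraph A B \<and> v \<in> verts B \<and> v' \<notin> verts B \<and>
    is_subgraph (add_edge B v v') t \<and> verts (add_edge B v v') = verts t"
  using A
proof (induction "card (verts t - verts A)" arbitrary: A rule: less_induct)
  case less
  have A: "simple_graph A" "verts A \<noteq> {}" "verts A \<subseteq> verts t"
    using less.prems by (auto simp: is_tree_def connected_graph_def is_subgraph_def)
  obtain a b where ab: "a \<in> verts A" "b \<notin> verts A" "{a, b} \<in> edges t"
    using connected_exit_edge[OF t(2,3) A(3,2) less.prems(3)] by blast
  let ?A = "add_edge A a b"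
  have tree: "is_tree ?A" using is_tree_add_leaf less.prems(1) ab by metis
  have sub: "is_subgraph ?A t" using is_subgraph_add_edge less.prems(2) t(2) ab(3) by metis
  show ?case
  proof (cases "verts ?A = verts t")
    case True
    then show ?thesis using less.prems(1) is_subgraph_refl[OF A(1)] ab sub by blast
  next
    case False
    have "b \<in> verts t" using simple_graph_edgeD(2)[OF t(2) ab(3)] .
    then have "verts t - verts ?A \<subset> verts t - verts A" using ab by auto
    then have "card (verts t - verts ?A) < card (verts t - verts A)"
      using t(1) by (intro psubset_card_mono) auto
    from less.hyps[OF this tree sub False] obtain B v v' where
      B: "is_tree B" "is_subgraph ?A B" "v \<in> verts B" "v' \<notin> verts B"
        "is_subgraph (add_edge B v v') t" "verts (add_edge B v v') = verts t"
      by blast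
    moreover have "is_subgraph A B" using B(2) A(1) by (simp add: is_subgraph_def)
    ultimately show ?thesis by blast
  qed
qed

text \<open>An edge of \<open>t\<close> missing from \<open>T\<close> would close a cycle with \<open>T\<close> inside \<open>t\<close>.\<close>
lemma tree_spanning_subgraph_eq:
  assumes "is_tree t" "is_subgraph T t" "connected_graph T" "verts T = verts t"
  shows "T = t"
proof -
  have t: "simple_graph t" and T: "simple_graph T" "edges T \<subseteq> edges t"
    using assms by (auto simp: is_tree_def is_subgraph_def)
  have "e \<in> edges T" if e: "e \<in> edges t" for e
  proof (rule ccontr)
    assume "e \<notin> edges T"
    obtain x y where xy: "x \<in> verts t" "y \<in> verts t" "x \<noteq> y" "e = {x, y}"
      using e t unfolding simple_graph_def by blast
    obtain c where c: "is_cycle (add_edge T x y) c"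
      using connected_add_edge_cycle[OF T(1) assms(3), of x y] xy \<open>e \<notin> edges T\<close> assms(4) by auto
    then have "cycle_edges c \<subseteq> edges t" using T(2) e xy by (auto simp: is_cycle_def)
    with is_cycle_transfer[OF c t] assms(1) show False by (auto simp: is_tree_def)
  qed
  then have "edges T = edges t" using T by blast
  with assms(4) show ?thesis by (simp add: ugraph.expand)
qed

text \<open>Writing \<open>t\<close> as \<open>B\<close> with a pendant edge \<open>vv'\<close> says at once that \<open>v'\<close> is a leaf, that it
  lies outside \<open>A\<close>, and that removing it leaves a tree.\<close>
lemma tree_remove_outer_leaf:
  assumes "finite (verts t)" "is_tree t" "is_tree A" "is_subgraph A t" "verts A \<noteq> verts t"
  obtains B v v' where "is_tree B" "is_subgraph A B" "v \<in> verts B" "v' \<notin> verts B"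
    "t = add_edge B v v'"
proof -
  have t: "simple_graph t" "connected_graph t" using assms(2) by (auto simp: is_tree_def)
  obtain B v v' where B: "is_tree B" "is_subgraph A B" "v \<in> verts B" "v' \<notin> verts B"
    "is_subgraph (add_edge B v v') t" "verts (add_edge B v v') = verts t"
    using connected_spanning_subtree[OF assms(1) t assms(3-5)] by blast
  have "is_tree (add_edge B v v')" using is_tree_add_leaf B by metis
  then have "add_edge B v v' = t"
    using tree_spanning_subgraph_eq[OF assms(2) B(5) _ B(6)] by (simp add: is_tree_def)
  with B show ?thesis using that by metis
qed

lemma card_add_leaf:
  assumes "finite (verts t)" "simple_graph t" "a \<in> verts t" "b \<notin> verts t"
  shows "card (verts (add_edge t a b)) = Suc (card (verts t))"
    and "card (edges (add_edge t a b)) = Suc (card (edges t))"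
proof -
  have "verts (add_edge t a b) = insert b (verts t)" using assms(3) by auto
  then show "card (verts (add_edge t a b)) = Suc (card (verts t))" using assms by simp
  have "{a, b} \<notin> edges t" using simple_graph_edgeD(2)[OF assms(2)] assms(4) by blast
  then show "card (edges (add_edge t a b)) = Suc (card (edges t))"
    using finite_edges[OF assms(2,1)] by simp
qed

lemma single_vertex_edges: "simple_graph t \<Longrightarrow> verts t = {v} \<Longrightarrow> edges t = {}"
  unfolding simple_graph_def by (metis all_not_in_conv singletonD)

lemma is_subgraph_single: "v \<in> verts t \<Longrightarrow> is_subgraph (UGraph {v} {}) t"
  by (simp add: is_subgraph_def simple_graph_def)

lemma tree_card:
  assumes "is_tree t" "finite (verts t)"
  shows "card (verts t) = Suc (card (edges t))"
  using assms
proof (induction "card (verts t)" arbitrary: t rule: less_induct)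
  case less
  have t: "simple_graph t" using less.prems by (simp add: is_tree_def)
  obtain v where v: "v \<in> verts t" using less.prems by (auto simp: is_tree_def connected_graph_def)
  show ?case
  proof (cases "verts t = {v}")
    case True
    then show ?thesis using single_vertex_edges[OF t True] by simp
  next
    case False
    then have "verts (UGraph {v} {}) \<noteq> verts t" by simp
    then obtain B x y where B: "is_tree B" "x \<in> verts B" "y \<notin> verts B" "t = add_edge B x y"
      using tree_remove_outer_leaf[OF less.prems(2,1) is_tree_single is_subgraph_single[OF v]]
      by blast
    have fin: "finite (verts B)" using less.prems(2) unfolding B(4) by simp
    have "simple_graph B" using B(1) by (simp add: is_tree_def)
    note card = card_add_leaf[OF fin this B(2,3), folded B(4)]
    then show ?thesis using less.hyps[OF _ B(1) fin] by simp
  qed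
qed

text \<open>A spanning subtree has the same number of edges as \<open>t\<close>, hence equals \<open>t\<close>.\<close>
lemma connected_card_imp_tree:
  assumes t: "finite (verts t)" "simple_graph t" "connected_graph t"
    and card: "card (verts t) = Suc (card (edges t))"
  shows "is_tree t"
proof -
  obtain v where v: "v \<in> verts t" using t(3) by (auto simp: connected_graph_def)
  show ?thesis
  proof (cases "verts t = {v}")
    case True
    then have "t = UGraph {v} {}" using single_vertex_edges[OF t(2) True] by (simp add: ugraph.expand)
    then show ?thesis using is_tree_single by simp
  next
    case False
    then have "verts (UGraph {v} {}) \<noteq> verts t" by simp
    then obtain B x y where B: "is_tree B" "x \<in> verts B" "y \<notin> verts B"
      "is_subgraph (add_edge B x y) t" "verts (add_edge B x y) = verts t"
      using connected_spanning_subtree[OF t is_tree_single is_subgraph_single[OF v]] by blast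
    have tree: "is_tree (add_edge B x y)" using is_tree_add_leaf[OF B(1-3)] .
    have "card (edges (add_edge B x y)) = card (edges t)"
      using tree_card[OF tree] card t(1) unfolding B(5) by simp
    then have "edges (add_edge B x y) = edges t"
      using B(4) finite_edges[OF t(2,1)] by (intro card_subset_eq) (auto simp: is_subgraph_def)
    with B(5) have "add_edge B x y = t" by (simp add: ugraph.expand)
    with tree show ?thesis by simp
  qed
qed

text \<open>The exchange keeps the graph connected and preserves both counts; the counting criterion then
  gives acyclicity without a look at the cycles that could remain.\<close>
lemma is_tree_exchange:
  assumes t: "is_tree t" "finite (verts t)"
    and u: "u \<in> verts t" "u' \<in> verts t" "u \<noteq> u'" "{u, u'} \<notin> edges t"
    and c: "is_cycle (add_edge t u u') c" "e \<in> cycle_edges c"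
  shows "is_tree (remove_edge (add_edge t u u') e)"
proof (rule connected_card_imp_tree)
  have s: "simple_graph t" "connected_graph t" using t by (auto simp: is_tree_def)
  note sH = simple_graph_add_edge[OF s(1) u(3)]
  show "simple_graph (remove_edge (add_edge t u u') e)" by (rule simple_graph_remove_edge[OF sH])
  show "connected_graph (remove_edge (add_edge t u u') e)"
    by (rule connected_remove_cycle_edge[OF sH connected_graph_add_edge[OF s u(1,3)] c])
  have "e \<in> edges (add_edge t u u')" using c by (auto simp: is_cycle_def)
  then have "card (edges (remove_edge (add_edge t u u') e)) = card (edges t)"
    using u(4) finite_edges[OF s(1) t(2)] by simp
  moreover have "verts (add_edge t u u') = verts t" using u by auto
  ultimately show "card (verts (remove_edge (add_edge t u u') e))
      = Suc (card (edges (remove_edge (add_edge t u u') e)))"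
    using tree_card[OF t] by simp
qed (use t in simp)

section \<open>Moves of the subtree chain\<close>

definition step_given_edge :: "'a ugraph \<Rightarrow> 'a ugraph \<Rightarrow> 'a \<Rightarrow> 'a \<Rightarrow> 'a ugraph pmf" where
  "step_given_edge G t u u' = (
     if u' \<notin> verts t then do {
       (v, v') \<leftarrow> random_oriented_edge G t;
       let t' = remove_leaf (add_edge t u u') v v';
       return_pmf (if {v, v'} \<in> edges t \<and> is_leaf t v' \<and> is_tree t' then t' else t)
     }
     else if {u, u'} \<in> edges t then return_pmf t
     else do {
       e \<leftarrow> cycle_pmf G (created_cycle t u u');
       return_pmf (remove_edge (add_edge t u u') e)
     })"

lemma subtree_step_alt:
  "subtree_step G t = bind_pmf (random_oriented_edge G t) (\<lambda>(u, u'). step_given_edge G t u u')"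
  unfolding subtree_step_def step_given_edge_def ..

locale subtree_chain =
  fixes G :: "'a ugraph" and n :: nat
  assumes finite_G: "finite (verts G)" and simple_G: "simple_graph G"
    and connected_G: "connected_graph G" and two_le_n: "2 \<le> n" and n_le: "n \<le> card (verts G)"
begin

lemma SubtreesD:
  assumes "t \<in> Subtrees G n"
  shows "is_tree t" "simple_graph t" "finite (verts t)" "verts t \<noteq> {}" "card (verts t) = n"
    "verts t \<subseteq> verts G" "edges t \<subseteq> edges G"
  using assms finite_G finite_subset
  by (auto simp: Subtrees_def is_subgraph_def is_tree_def connected_graph_def)

lemma finite_Subtrees: "finite (Subtrees G n)"
proof (rule finite_subset)
  show "Subtrees G n \<subseteq> (\<lambda>(V, E). UGraph V E) ` (Pow (verts G) \<times> Pow (edges G))"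
  proof
    fix t assume "t \<in> Subtrees G n"
    then show "t \<in> (\<lambda>(V, E). UGraph V E) ` (Pow (verts G) \<times> Pow (edges G))"
      using SubtreesD[of t] by (intro image_eqI[of _ _ "(verts t, edges t)"]) auto
  qed
qed (use finite_G finite_edges[OF simple_G] in auto)

lemma finite_neighbours: "finite (neighbours G u)"
  using simple_graph_edgeD(2)[OF simple_G]
  by (intro finite_subset[OF _ finite_G]) (auto simp: neighbours_def)

lemma degree_pos: "{u, u'} \<in> edges G \<Longrightarrow> 0 < degree G u"
  using finite_neighbours by (auto simp: degree_def card_gt_0_iff neighbours_def)

lemma neighbours_nonempty:
  assumes "u \<in> verts G"
  shows "neighbours G u \<noteq> {}"
proof -
  have "card {u} \<noteq> card (verts G)" using two_le_n n_le by simp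
  then have "{u} \<noteq> verts G" by metis
  then obtain b where "{u, b} \<in> edges G"
    using connected_exit_edge[OF simple_G connected_G, of "{u}"] assms by auto
  then show ?thesis by (auto simp: neighbours_def)
qed

lemma pmf_random_oriented_edge:
  assumes t: "t \<in> Subtrees G n"
  shows "pmf (random_oriented_edge G t) (u, u') =
    (if u \<in> verts t \<and> {u, u'} \<in> edges G then 1 / (real n * real (degree G u)) else 0)"
proof -
  let ?q = "\<lambda>x. pmf_of_set (neighbours G x)"
  have "random_oriented_edge G t = bind_pmf (pmf_of_set (verts t)) (\<lambda>x. map_pmf (Pair x) (?q x))"
    by (simp add: random_oriented_edge_def map_pmf_def)
  moreover have "pmf (map_pmf (Pair x) (?q x)) (u, u') = (if x = u then pmf (?q x) u' else 0)" for x
    by (auto simp: pmf_map_inj' inj_on_def intro!: pmf_map_outside)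
  ultimately have "pmf (random_oriented_edge G t) (u, u')
      = (\<Sum>x\<in>verts t. pmf (pmf_of_set (verts t)) x * (if x = u then pmf (?q x) u' else 0))"
    using SubtreesD[OF t] by (simp add: pmf_bind_finite[of "verts t"])
  also have "\<dots> = (if u \<in> verts t then 1 / real n * pmf (?q u) u' else 0)"
    using SubtreesD[OF t] by (simp add: if_distrib[of "\<lambda>r. _ * r"] cong: if_cong)
  also have "u \<in> verts t \<Longrightarrow> pmf (?q u) u' = indicator (neighbours G u) u' / real (degree G u)"
    using finite_neighbours neighbours_nonempty SubtreesD(6)[OF t]
    by (subst pmf_of_set) (auto simp: degree_def)
  then have "(if u \<in> verts t then 1 / real n * pmf (?q u) u' else 0) =
      (if u \<in> verts t \<and> {u, u'} \<in> edges G then 1 / (real n * real (degree G u)) else 0)"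
    by (auto simp: neighbours_def)
  finally show ?thesis .
qed

lemma set_random_oriented_edge:
  assumes t: "t \<in> Subtrees G n"
  shows "set_pmf (random_oriented_edge G t) = {(u, u'). u \<in> verts t \<and> {u, u'} \<in> edges G}"
proof -
  have "(u, u') \<in> set_pmf (random_oriented_edge G t) \<longleftrightarrow> u \<in> verts t \<and> {u, u'} \<in> edges G" for u u'
    using two_le_n degree_pos[of u u'] by (auto simp: set_pmf_iff pmf_random_oriented_edge[OF t])
  then show ?thesis by auto
qed

lemma edge_weight_pos:
  assumes "e \<in> edges G"
  shows "0 < edge_weight G e"
proof -
  obtain x y where xy: "x \<noteq> y" "e = {x, y}" using assms simple_G unfolding simple_graph_def by blast
  then have "0 < degree G x" "0 < degree G y"
    using assms degree_pos[of x y] degree_pos[of y x] by (auto simp: insert_commute)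
  then show ?thesis using xy by (simp add: edge_weight_def add_pos_pos)
qed

lemma finite_cycle_edges: "finite (cycle_edges c)"
  by (simp add: cycle_edges_def)

lemma pmf_cycle_pmf:
  assumes c: "is_cycle G c"
  shows "pmf (cycle_pmf G c) e =
    (if e \<in> cycle_edges c then cycle_const G c * edge_weight G e else 0)"
  unfolding cycle_pmf_def
proof (rule pmf_embed_pmf)
  have sub: "cycle_edges c \<subseteq> edges G" using c by (simp add: is_cycle_def)
  have "{c ! 0, c ! (Suc 0 mod length c)} \<in> cycle_edges c"
    using c by (auto simp: cycle_edges_def is_cycle_def intro!: exI[of _ 0])
  then have pos: "0 < (\<Sum>e\<in>cycle_edges c. edge_weight G e)"
    using edge_weight_pos sub finite_cycle_edges by (intro sum_pos) auto
  have nonneg: "0 \<le> cycle_const G c * edge_weight G e" if "e \<in> cycle_edges c" for e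
    using pos edge_weight_pos[of e] that sub by (auto simp: cycle_const_def)
  then show "0 \<le> (if e \<in> cycle_edges c then cycle_const G c * edge_weight G e else 0)" for e
    by simp
  have "(\<integral>\<^sup>+ e. ennreal (if e \<in> cycle_edges c then cycle_const G c * edge_weight G e else 0)
      \<partial>count_space UNIV) = (\<Sum>e\<in>cycle_edges c.
        ennreal (if e \<in> cycle_edges c then cycle_const G c * edge_weight G e else 0))"
    by (rule nn_integral_count_space'[OF finite_cycle_edges]) auto
  also have "\<dots> = (\<Sum>e\<in>cycle_edges c. ennreal (cycle_const G c * edge_weight G e))"
    by (rule sum.cong) auto
  also have "\<dots> = ennreal (\<Sum>e\<in>cycle_edges c. cycle_const G c * edge_weight G e)"
    using nonneg by (rule sum_ennreal)
  also have "(\<Sum>e\<in>cycle_edges c. cycle_const G c * edge_weight G e) = 1"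
    using pos by (simp add: cycle_const_def flip: sum_divide_distrib)
  finally show "(\<integral>\<^sup>+ e. ennreal (if e \<in> cycle_edges c then cycle_const G c * edge_weight G e else 0)
      \<partial>count_space UNIV) = 1" by simp
qed

lemma set_cycle_pmf:
  assumes c: "is_cycle G c"
  shows "set_pmf (cycle_pmf G c) = cycle_edges c"
proof -
  have sub: "cycle_edges c \<subseteq> edges G" using c by (simp add: is_cycle_def)
  have "0 < (\<Sum>e\<in>cycle_edges c. edge_weight G e)" if "e \<in> cycle_edges c" for e
    using edge_weight_pos sub finite_cycle_edges that by (intro sum_pos) auto
  then have "cycle_const G c * edge_weight G e \<noteq> 0" if "e \<in> cycle_edges c" for e
    using edge_weight_pos[of e] that sub by (force simp: cycle_const_def)
  then show ?thesis by (auto simp: set_pmf_iff pmf_cycle_pmf[OF c] split: if_splits)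
qed

text \<open>Since \<open>t\<close> has no cycle, any cycle of \<open>t + uu'\<close> passes through the new edge.\<close>
lemma created_cycle:
  assumes t: "t \<in> Subtrees G n" and u: "u \<in> verts t" "u' \<in> verts t"
    and e: "{u, u'} \<in> edges G" "{u, u'} \<notin> edges t"
  shows "is_cycle (add_edge t u u') (created_cycle t u u')"
    and "is_cycle G (created_cycle t u u')"
    and "{u, u'} \<in> cycle_edges (created_cycle t u u')"
proof -
  note T = SubtreesD[OF t]
  have "u \<noteq> u'" using simple_graph_edgeD(3)[OF simple_G e(1)] .
  have "connected_graph t" using T(1) by (simp add: is_tree_def)
  then show c: "is_cycle (add_edge t u u') (created_cycle t u u')"
    unfolding created_cycle_def
    using connected_add_edge_cycle[OF T(2) _ u \<open>u \<noteq> u'\<close> e(2)] by (metis someI_ex)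
  then have sub: "cycle_edges (created_cycle t u u') \<subseteq> insert {u, u'} (edges t)"
    by (simp add: is_cycle_def)
  then show "is_cycle G (created_cycle t u u')"
    using is_cycle_transfer[OF c simple_G] T(7) e(1) by blast
  show "{u, u'} \<in> cycle_edges (created_cycle t u u')"
  proof (rule ccontr)
    assume "{u, u'} \<notin> cycle_edges (created_cycle t u u')"
    then have "is_cycle t (created_cycle t u u')"
      using is_cycle_transfer[OF c T(2)] sub by blast
    then show False using T(1) by (auto simp: is_tree_def)
  qed
qed

lemma leaf_move_in_Subtrees:
  assumes t: "t \<in> Subtrees G n" and u: "u \<in> verts t" "u' \<notin> verts t" "{u, u'} \<in> edges G"
    and v: "{v, v'} \<in> edges t" and tree: "is_tree (remove_leaf (add_edge t u u') v v')"
  shows "remove_leaf (add_edge t u u') v v' \<in> Subtrees G n"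
proof -
  note T = SubtreesD[OF t]
  have "v' \<in> verts t" using simple_graph_edgeD(2)[OF T(2) v] .
  moreover have "verts (add_edge t u u') = insert u' (verts t)" using u by auto
  ultimately have "card (verts (remove_leaf (add_edge t u u') v v')) = n"
    using T(3,5) u(2) by simp
  moreover have "is_subgraph (remove_leaf (add_edge t u u') v v') G"
    using tree T(6,7) u simple_graph_edgeD[OF simple_G u(3)]
    by (auto simp: is_subgraph_def is_tree_def)
  ultimately show ?thesis using tree by (simp add: Subtrees_def)
qed

lemma cycle_move_in_Subtrees:
  assumes t: "t \<in> Subtrees G n" and u: "u \<in> verts t" "u' \<in> verts t"
    "{u, u'} \<in> edges G" "{u, u'} \<notin> edges t"
    and e: "e \<in> cycle_edges (created_cycle t u u')"
  shows "remove_edge (add_edge t u u') e \<in> Subtrees G n"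
proof -
  note T = SubtreesD[OF t]
  have "u \<noteq> u'" using simple_graph_edgeD(3)[OF simple_G u(3)] .
  have "is_tree (remove_edge (add_edge t u u') e)"
    using is_tree_exchange[OF T(1,3) u(1,2) \<open>u \<noteq> u'\<close> u(4) created_cycle(1)[OF t u] e] .
  moreover have "verts (add_edge t u u') = verts t" using u by auto
  ultimately show ?thesis
    using T u by (auto simp: Subtrees_def is_subgraph_def is_tree_def)
qed

lemma kernel_on_Subtrees: "kernel_on (Subtrees G n) (subtree_step G)"
  unfolding kernel_on_def
proof (intro ballI subsetI)
  fix t t' assume t: "t \<in> Subtrees G n" and t': "t' \<in> set_pmf (subtree_step G t)"
  from t' obtain u u' where u: "u \<in> verts t" "{u, u'} \<in> edges G"
    and t'1: "t' \<in> set_pmf (step_given_edge G t u u')"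
    unfolding subtree_step_alt set_bind_pmf set_random_oriented_edge[OF t] by auto
  show "t' \<in> Subtrees G n"
  proof (cases "u' \<in> verts t")
    case False
    then show ?thesis
      using t'1 t leaf_move_in_Subtrees[OF t u(1) False u(2)]
      by (auto simp: step_given_edge_def Let_def split: if_splits)
  next
    case True
    show ?thesis
    proof (cases "{u, u'} \<in> edges t")
      case False
      with t'1 True obtain e where "e \<in> cycle_edges (created_cycle t u u')"
        "t' = remove_edge (add_edge t u u') e"
        using set_cycle_pmf[OF created_cycle(2)[OF t u(1) True u(2) False]]
        by (auto simp: step_given_edge_def)
      then show ?thesis using cycle_move_in_Subtrees[OF t u(1) True u(2) False] by simp
    qed (use True t'1 t in \<open>simp add: step_given_edge_def\<close>)
  qed
qed

lemma stay_possible: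
  assumes t: "t \<in> Subtrees G n"
  shows "t \<in> set_pmf (subtree_step G t)"
proof -
  note T = SubtreesD[OF t]
  obtain u where u: "u \<in> verts t" using T(4) by blast
  have "card {u} \<noteq> card (verts t)" using T(5) two_le_n by simp
  then have "{u} \<noteq> verts t" by metis
  then obtain u' where u': "{u, u'} \<in> edges t"
    using connected_exit_edge[OF T(2), of "{u}"] T(1) u by (auto simp: is_tree_def)
  then have "u' \<in> verts t" using simple_graph_edgeD(2)[OF T(2)] by blast
  then have "t \<in> set_pmf (step_given_edge G t u u')" using u' by (simp add: step_given_edge_def)
  with u u' T(7) show ?thesis
    unfolding subtree_step_alt set_bind_pmf set_random_oriented_edge[OF t]
    by (intro UN_I[of "(u, u')"]) auto
qed

lemma leaf_move_possible:
  assumes t: "t \<in> Subtrees G n" and u: "u \<in> verts t" "u' \<notin> verts t" "{u, u'} \<in> edges G"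
    and v: "{v, v'} \<in> edges t" "is_leaf t v'" and tree: "is_tree (remove_leaf (add_edge t u u') v v')"
  shows "remove_leaf (add_edge t u u') v v' \<in> set_pmf (subtree_step G t)"
proof -
  note T = SubtreesD[OF t]
  have "(u, u') \<in> {(u, u'). u \<in> verts t \<and> {u, u'} \<in> edges G}"
    "(v, v') \<in> {(u, u'). u \<in> verts t \<and> {u, u'} \<in> edges G}"
    using u v(1) T(7) simple_graph_edgeD(1)[OF T(2) v(1)] by auto
  then have "remove_leaf (add_edge t u u') v v' \<in> set_pmf (step_given_edge G t u u')"
    using v tree
    unfolding step_given_edge_def Let_def if_P[OF u(2)] set_bind_pmf set_random_oriented_edge[OF t]
    by (intro UN_I[of "(v, v')"]) auto
  with u show ?thesis
    unfolding subtree_step_alt set_bind_pmf set_random_oriented_edge[OF t]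
    by (intro UN_I[of "(u, u')"]) auto
qed

lemma cycle_move_possible:
  assumes t: "t \<in> Subtrees G n" and u: "u \<in> verts t" "u' \<in> verts t"
    "{u, u'} \<in> edges G" "{u, u'} \<notin> edges t"
    and e: "e \<in> cycle_edges (created_cycle t u u')"
  shows "remove_edge (add_edge t u u') e \<in> set_pmf (subtree_step G t)"
proof -
  have "remove_edge (add_edge t u u') e \<in> set_pmf (step_given_edge G t u u')"
    using u e set_cycle_pmf[OF created_cycle(2)[OF t u]] by (auto simp: step_given_edge_def)
  with u show ?thesis
    unfolding subtree_step_alt set_bind_pmf set_random_oriented_edge[OF t]
    by (intro UN_I[of "(u, u')"]) auto
qed

section \<open>Symmetry of the kernel\<close>

definition oriented_edges :: "('a \<times> 'a) set" where
  "oriented_edges = {(u, u'). {u, u'} \<in> edges G}"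

lemma finite_oriented_edges: "finite oriented_edges"
proof (rule finite_subset)
  show "oriented_edges \<subseteq> verts G \<times> verts G"
    using simple_graph_edgeD(1,2)[OF simple_G] by (auto simp: oriented_edges_def)
qed (use finite_G in simp)

text \<open>Splits the weight of an undirected edge into the contributions of its two orientations.\<close>
lemma sum_edges_by_orientation:
  fixes g :: "'a set \<Rightarrow> real"
  assumes C: "C \<subseteq> edges G"
  shows "(\<Sum>e\<in>C. g e * (\<Sum>x\<in>e. h x)) =
    (\<Sum>(v, v')\<in>oriented_edges. if {v, v'} \<in> C then g {v, v'} * h v else 0)"
proof -
  have fin: "finite C" using C finite_edges[OF simple_G finite_G] finite_subset by blast
  have edge: "\<exists>x y. x \<noteq> y \<and> e = {x, y}" if "e \<in> C" for e
    using that C simple_G unfolding simple_graph_def by blast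
  then have "finite e" if "e \<in> C" for e using that by fastforce
  then have "(\<Sum>e\<in>C. g e * (\<Sum>x\<in>e. h x)) = (\<Sum>(e, x)\<in>Sigma C (\<lambda>e. e). g e * h x)"
    using fin by (simp add: sum_distrib_left sum.Sigma)
  also have "Sigma C (\<lambda>e. e) = (\<lambda>(v, v'). ({v, v'}, v)) ` {(v, v'). {v, v'} \<in> C}"
  proof (intro equalityI subsetI)
    fix p assume "p \<in> Sigma C (\<lambda>e. e)"
    then obtain e v where p: "p = (e, v)" "e \<in> C" "v \<in> e" by auto
    then obtain v' where "e = {v, v'}" using edge[OF p(2)] by blast
    with p show "p \<in> (\<lambda>(v, v'). ({v, v'}, v)) ` {(v, v'). {v, v'} \<in> C}"
      by (intro image_eqI[of _ _ "(v, v')"]) auto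
  qed auto
  also have "(\<Sum>(e, x)\<in>\<dots>. g e * h x) = (\<Sum>(v, v')\<in>{(v, v'). {v, v'} \<in> C}. g {v, v'} * h v)"
    by (subst sum.reindex) (auto simp: inj_on_def doubleton_eq_iff case_prod_beta)
  also have "\<dots> = (\<Sum>(v, v')\<in>oriented_edges. if {v, v'} \<in> C then g {v, v'} * h v else 0)"
    using C finite_oriented_edges by (intro sum.mono_neutral_cong_left) (auto simp: oriented_edges_def split: if_splits)
  finally show ?thesis .
qed

text \<open>The requirement of the chain that the result be a tree is supplied by \<open>t'\<close> being a subtree
  wherever this relation is used.\<close>
definition leaf_move :: "'a ugraph \<Rightarrow> 'a \<times> 'a \<Rightarrow> 'a \<times> 'a \<Rightarrow> 'a ugraph \<Rightarrow> bool" where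
  "leaf_move t = (\<lambda>(u, u') (v, v') t'. u \<in> verts t \<and> u' \<notin> verts t \<and> v \<in> verts t \<and>
     {v, v'} \<in> edges t \<and> is_leaf t v' \<and> t' = remove_leaf (add_edge t u u') v v')"

definition cycle_move :: "'a ugraph \<Rightarrow> 'a \<times> 'a \<Rightarrow> 'a \<times> 'a \<Rightarrow> 'a ugraph \<Rightarrow> bool" where
  "cycle_move t = (\<lambda>(u, u') (v, v') t'. u \<in> verts t \<and> u' \<in> verts t \<and> {u, u'} \<notin> edges t \<and>
     {v, v'} \<in> cycle_edges (created_cycle t u u') \<and>
     t' = remove_edge (add_edge t u u') {v, v'})"

definition origin_weight :: "'a \<times> 'a \<Rightarrow> real" where
  "origin_weight x = 1 / real (degree G (fst x))"

text \<open>What remains of the probability of a cycle move after the degrees of \<open>u\<close> and \<open>v\<close> have been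
  factored out.\<close>
definition cycle_factor :: "'a ugraph \<Rightarrow> 'a \<times> 'a \<Rightarrow> real" where
  "cycle_factor t x = cycle_const G (created_cycle t (fst x) (snd x)) / real n"

definition move_rate :: "'a ugraph \<Rightarrow> 'a \<times> 'a \<Rightarrow> 'a \<times> 'a \<Rightarrow> 'a ugraph \<Rightarrow> real" where
  "move_rate t x y t' = (if leaf_move t x y t' then 1 / (real n)\<^sup>2 else 0) +
     (if cycle_move t x y t' then cycle_factor t x else 0)"

text \<open>The removed oriented edge \<open>vv'\<close> attaches \<open>v'\<close> to \<open>t'\<close> again, and \<open>u'\<close>, whose only
  neighbour in \<open>t'\<close> is \<open>u\<close>, is a leaf of \<open>t'\<close>. The point to check is that \<open>u\<close> survives: if \<open>u =
  v'\<close>, then the edge \<open>uu'\<close> would hang at a deleted vertex and \<open>t'\<close> would not be a simple graph.\<close>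
lemma leaf_move_sym:
  assumes t: "t \<in> Subtrees G n" and t': "t' \<in> Subtrees G n" and move: "leaf_move t x y t'"
  shows "leaf_move t' y x t"
proof -
  obtain u u' v v' where xy: "x = (u, u')" "y = (v, v')" by (metis surj_pair)
  note T = SubtreesD[OF t] and T' = SubtreesD[OF t']
  have u: "u \<in> verts t" "u' \<notin> verts t" and v: "v \<in> verts t" "{v, v'} \<in> edges t"
    and t'_eq: "t' = remove_leaf (add_edge t u u') v v'"
    using move by (auto simp: leaf_move_def xy)
  have v': "v' \<in> verts t" "v \<noteq> v'" using simple_graph_edgeD[OF T(2) v(2)] by auto
  have nb: "{u', w} \<notin> edges t" for w using simple_graph_edgeD(1)[OF T(2)] u(2) by blast
  have ne: "{u, u'} \<noteq> {v, v'}" using u v v' by (auto simp: doubleton_eq_iff)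
  then have new: "{u, u'} \<in> edges t'" by (simp add: t'_eq)
  note uu = simple_graph_edgeD[OF T'(2) new]
  have "neighbours t' u' = {u}"
    using nb ne by (auto simp: neighbours_def t'_eq insert_commute doubleton_eq_iff)
  then have "is_leaf t' u'" using uu by (simp add: is_leaf_def degree_def)
  moreover have "t = remove_leaf (add_edge t' v v') u u'"
  proof (rule ugraph.expand, intro conjI)
    show "verts t = verts (remove_leaf (add_edge t' v v') u u')"
      using u v v' by (auto simp: t'_eq)
    show "edges t = edges (remove_leaf (add_edge t' v v') u u')"
      using v nb[of u] by (auto simp: t'_eq insert_commute)
  qed
  moreover have "v \<in> verts t'" "v' \<notin> verts t'" using v v' by (auto simp: t'_eq)
  ultimately show ?thesis
    using uu(1) new unfolding leaf_move_def xy prod.case by blast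
qed

text \<open>Both trees become the same graph \<open>t + uu' = t' + vv'\<close> once the missing edge is added, so
  the same cycle is chosen in both directions.\<close>
lemma cycle_move_sym:
  assumes t: "t \<in> Subtrees G n" and x: "x \<in> oriented_edges" and y: "y \<in> oriented_edges"
    and move: "cycle_move t x y t'" and ne: "t' \<noteq> t"
  shows "cycle_move t' y x t" and "cycle_factor t' y = cycle_factor t x"
proof -
  obtain u u' v v' where xy: "x = (u, u')" "y = (v, v')" by (metis surj_pair)
  note T = SubtreesD[OF t]
  have u: "u \<in> verts t" "u' \<in> verts t" "{u, u'} \<in> edges G" "{u, u'} \<notin> edges t"
    and v: "{v, v'} \<in> cycle_edges (created_cycle t u u')"
    and t'_eq: "t' = remove_edge (add_edge t u u') {v, v'}"
    using move x by (auto simp: cycle_move_def oriented_edges_def xy)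
  note c = created_cycle[OF t u]
  have "{v, v'} \<in> insert {u, u'} (edges t)" using v c(1) by (auto simp: is_cycle_def)
  moreover have "{v, v'} \<noteq> {u, u'}"
  proof
    assume "{v, v'} = {u, u'}"
    then have "t' = t" using u by (intro ugraph.expand) (auto simp: t'_eq)
    with ne show False by simp
  qed
  ultimately have vt: "{v, v'} \<in> edges t" by simp
  have vv: "v \<in> verts t" "v' \<in> verts t" using simple_graph_edgeD[OF T(2) vt] by auto
  have H: "add_edge t' v v' = add_edge t u u'"
    using u vt vv by (intro ugraph.expand) (auto simp: t'_eq)
  then have cc: "created_cycle t' v v' = created_cycle t u u'"
    by (simp add: created_cycle_def)
  then show "cycle_factor t' y = cycle_factor t x" by (simp add: cycle_factor_def xy)
  have "t = remove_edge (add_edge t' v v') {u, u'}"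
    unfolding H using u by (intro ugraph.expand) auto
  moreover have "verts t' = verts t" "{v, v'} \<notin> edges t'" using u by (auto simp: t'_eq)
  ultimately show "cycle_move t' y x t"
    using c(3) vv unfolding cycle_move_def xy prod.case cc by metis
qed

lemma move_rate_sym:
  assumes "t \<in> Subtrees G n" "t' \<in> Subtrees G n" "t \<noteq> t'" "x \<in> oriented_edges" "y \<in> oriented_edges"
  shows "move_rate t x y t' = move_rate t' y x t"
proof -
  have "leaf_move t x y t' \<longleftrightarrow> leaf_move t' y x t"
    using leaf_move_sym assms by metis
  moreover have "cycle_move t x y t' \<longleftrightarrow> cycle_move t' y x t"
    using cycle_move_sym(1) assms by metis
  moreover have "cycle_move t x y t' \<Longrightarrow> cycle_factor t' y = cycle_factor t x"
    using cycle_move_sym(2) assms by metis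
  ultimately show ?thesis by (simp add: move_rate_def)
qed

lemma pmf_step_given_edge:
  assumes t: "t \<in> Subtrees G n" and t': "t' \<in> Subtrees G n" and ne: "t \<noteq> t'" and x: "x \<in> oriented_edges"
  shows "pmf (random_oriented_edge G t) x * pmf (case x of (u, u') \<Rightarrow> step_given_edge G t u u') t' =
    (\<Sum>y\<in>oriented_edges. origin_weight x * origin_weight y * move_rate t x y t')"
proof -
  obtain u u' where xu: "x = (u, u')" by (metis surj_pair)
  have uG: "{u, u'} \<in> edges G" using x by (simp add: xu oriented_edges_def)
  have px: "pmf (random_oriented_edge G t) x = (if u \<in> verts t then origin_weight x / real n else 0)"
    using uG by (simp add: xu pmf_random_oriented_edge[OF t] origin_weight_def)
  consider "u \<notin> verts t" | "u \<in> verts t" "u' \<notin> verts t"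
    | "u \<in> verts t" "u' \<in> verts t" "{u, u'} \<in> edges t"
    | "u \<in> verts t" "u' \<in> verts t" "{u, u'} \<notin> edges t" by blast
  then show ?thesis
  proof cases
    case 1
    then have "move_rate t x y t' = 0" for y
      by (auto simp: move_rate_def leaf_move_def cycle_move_def xu)
    then show ?thesis using 1 px by simp
  next
    case 2
    have set: "set_pmf (random_oriented_edge G t) \<subseteq> oriented_edges"
      using set_random_oriented_edge[OF t] by (auto simp: oriented_edges_def)
    define f where "f = (\<lambda>(v, v'). let s = remove_leaf (add_edge t u u') v v' in
      return_pmf (if {v, v'} \<in> edges t \<and> is_leaf t v' \<and> is_tree s then s else t))"
    have "pmf (random_oriented_edge G t) y * pmf (f y) t' =
        origin_weight y * real n * move_rate t x y t'" if y: "y \<in> oriented_edges" for y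
    proof -
      obtain v v' where yv: "y = (v, v')" by (metis surj_pair)
      have "pmf (random_oriented_edge G t) y = (if v \<in> verts t then origin_weight y / real n else 0)"
        using y by (simp add: yv pmf_random_oriented_edge[OF t] origin_weight_def oriented_edges_def)
      moreover have "v \<in> verts t \<Longrightarrow> pmf (f y) t' = (if leaf_move t x y t' then 1 else 0)"
        using 2 ne SubtreesD(1)[OF t'] by (auto simp: f_def yv xu leaf_move_def Let_def)
      moreover have "\<not> cycle_move t x y t'" using 2 by (simp add: cycle_move_def xu yv)
      moreover have "leaf_move t x y t' \<Longrightarrow> v \<in> verts t" by (simp add: leaf_move_def xu yv)
      ultimately show ?thesis using two_le_n by (auto simp: move_rate_def power2_eq_square)
    qed
    moreover have "pmf (step_given_edge G t u u') t' =
        (\<Sum>y\<in>oriented_edges. pmf (random_oriented_edge G t) y * pmf (f y) t')"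
      using 2 pmf_bind_finite[OF finite_oriented_edges set, of f t'] by (simp add: step_given_edge_def f_def)
    ultimately have "pmf (step_given_edge G t u u') t' =
        (\<Sum>y\<in>oriented_edges. origin_weight y * real n * move_rate t x y t')" by simp
    then show ?thesis
      unfolding px using 2 two_le_n by (simp add: xu sum_distrib_left mult.assoc)
  next
    case 3
    then have "move_rate t x y t' = 0" for y
      by (auto simp: move_rate_def leaf_move_def cycle_move_def xu)
    then show ?thesis using 3 ne by (simp add: xu step_given_edge_def)
  next
    case 4
    let ?c = "created_cycle t u u'" and ?H = "add_edge t u u'"
    have c: "is_cycle G ?c" using created_cycle(2)[OF t 4(1,2) uG 4(3)] .
    then have sub: "cycle_edges ?c \<subseteq> edges G" by (simp add: is_cycle_def)
    define g where "g e = (if t' = remove_edge ?H e then cycle_const G ?c else 0)" for e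
    have "step_given_edge G t u u' = bind_pmf (cycle_pmf G ?c) (\<lambda>e. return_pmf (remove_edge ?H e))"
      using 4 by (simp add: step_given_edge_def)
    then have "pmf (step_given_edge G t u u') t' =
        (\<Sum>e\<in>cycle_edges ?c. pmf (cycle_pmf G ?c) e * pmf (return_pmf (remove_edge ?H e)) t')"
      using pmf_bind_finite[OF finite_cycle_edges equalityD1[OF set_cycle_pmf[OF c]]] by metis
    also have "\<dots> = (\<Sum>e\<in>cycle_edges ?c. g e * (\<Sum>x\<in>e. 1 / real (degree G x)))"
      by (intro sum.cong) (auto simp: pmf_cycle_pmf[OF c] g_def edge_weight_def)
    also have "\<dots> = (\<Sum>y\<in>oriented_edges. origin_weight y * real n * move_rate t x y t')"
      unfolding sum_edges_by_orientation[OF sub]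
    proof (intro sum.cong refl)
      fix y assume "y \<in> oriented_edges"
      obtain v v' where yv: "y = (v, v')" by (metis surj_pair)
      show "(case y of (v, v') \<Rightarrow>
          if {v, v'} \<in> cycle_edges ?c then g {v, v'} * (1 / real (degree G v)) else 0) =
        origin_weight y * real n * move_rate t x y t'"
        using 4 two_le_n by (simp add: move_rate_def leaf_move_def cycle_move_def cycle_factor_def
            xu yv origin_weight_def g_def)
    qed
    finally show ?thesis
      unfolding px using 4 two_le_n by (simp add: xu sum_distrib_left mult.assoc)
  qed
qed

lemma subtree_step_sym:
  assumes t: "t \<in> Subtrees G n" and t': "t' \<in> Subtrees G n"
  shows "pmf (subtree_step G t) t' = pmf (subtree_step G t') t"
proof (cases "t = t'")
  case False
  have pmf: "pmf (subtree_step G s) s' =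
      (\<Sum>x\<in>oriented_edges. \<Sum>y\<in>oriented_edges. origin_weight x * origin_weight y * move_rate s x y s')"
    if s: "s \<in> Subtrees G n" and s': "s' \<in> Subtrees G n" and "s \<noteq> s'" for s s'
  proof -
    have "set_pmf (random_oriented_edge G s) \<subseteq> oriented_edges"
      using set_random_oriented_edge[OF s] by (auto simp: oriented_edges_def)
    from pmf_bind_finite[OF finite_oriented_edges this] show ?thesis
      unfolding subtree_step_alt using pmf_step_given_edge[OF that] by (metis (no_types, lifting) sum.cong)
  qed
  have "pmf (subtree_step G t) t' =
      (\<Sum>x\<in>oriented_edges. \<Sum>y\<in>oriented_edges. origin_weight y * origin_weight x * move_rate t' y x t)"
    unfolding pmf[OF t t' False]
    by (intro sum.cong refl) (simp add: move_rate_sym[OF t t' False] mult.commute)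
  also have "\<dots> = (\<Sum>y\<in>oriented_edges. \<Sum>x\<in>oriented_edges. origin_weight y * origin_weight x * move_rate t' y x t)"
    by (rule sum.swap)
  also have "\<dots> = pmf (subtree_step G t') t"
    using pmf[OF t' t] False by simp
  finally show ?thesis .
qed simp

section \<open>Irreducibility\<close>

lemma cycle_leaves_tree:
  assumes "is_tree A" "is_cycle H c"
  obtains e where "e \<in> cycle_edges c" "e \<notin> edges A"
  using is_cycle_transfer[OF assms(2), of A] assms(1) unfolding is_tree_def by blast

text \<open>One step suffices: stay put, make a leaf move that drops a leaf outside \<open>A\<close>, or make a cycle
  move that removes an edge outside \<open>A + ab\<close>.\<close>
lemma extend_common_subtree:
  assumes t: "t \<in> Subtrees G n" and A: "is_tree A" "is_subgraph A t" "card (verts A) < n"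
    and ab: "a \<in> verts A" "b \<notin> verts A" "{a, b} \<in> edges G"
  shows "\<exists>t'\<in>Subtrees G n. t' \<in> set_pmf (subtree_step G t) \<and> is_subgraph (add_edge A a b) t'"
proof -
  note T = SubtreesD[OF t]
  have at: "a \<in> verts t" using A ab by (auto simp: is_subgraph_def)
  have Ab: "is_tree (add_edge A a b)" using is_tree_add_leaf[OF A(1) ab(1,2)] .
  consider (old) "{a, b} \<in> edges t" | (leaf) "b \<notin> verts t"
    | (cycle) "b \<in> verts t" "{a, b} \<notin> edges t" by blast
  then show ?thesis
  proof cases
    case old
    then show ?thesis
      using is_subgraph_add_edge[OF A(2) T(2)] stay_possible[OF t] t by blast
  next
    case leaf
    have "verts A \<noteq> verts t" using A(3) T(5) by auto
    then obtain B v v' where B: "is_tree B" "is_subgraph A B" "v \<in> verts B" "v' \<notin> verts B"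
      "t = add_edge B v v'"
      using tree_remove_outer_leaf[OF T(3,1) A(1,2)] by blast
    have sB: "simple_graph B" using B(1) by (simp add: is_tree_def)
    have nb: "{w, v'} \<notin> edges B" for w using simple_graph_edgeD(2)[OF sB] B(4) by blast
    have aB: "a \<in> verts B" using B(2) ab(1) by (auto simp: is_subgraph_def)
    have "b \<notin> verts B" "b \<noteq> v" "b \<noteq> v'" using leaf B(5) by auto
    have "neighbours t v' = {v}"
      using nb by (auto simp: neighbours_def B(5) insert_commute doubleton_eq_iff)
    then have "is_leaf t v'" by (simp add: is_leaf_def degree_def B(5))
    have "a \<noteq> v'" "v \<noteq> v'" using aB B(3,4) by auto
    then have "{a, b} \<noteq> {v, v'}" using \<open>b \<noteq> v'\<close> by (auto simp: doubleton_eq_iff)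
    then have "edges (remove_leaf (add_edge t a b) v v') = edges (add_edge B a b)"
      using nb[of v] by (auto simp: B(5))
    moreover have "verts (remove_leaf (add_edge t a b) v v') = verts (add_edge B a b)"
      using aB B(3,4) \<open>b \<noteq> v'\<close> by (auto simp: B(5))
    ultimately have eq: "remove_leaf (add_edge t a b) v v' = add_edge B a b"
      by (intro ugraph.expand) simp
    have tree: "is_tree (remove_leaf (add_edge t a b) v v')"
      unfolding eq using is_tree_add_leaf[OF B(1) aB \<open>b \<notin> verts B\<close>] .
    have "{v, v'} \<in> edges t" by (simp add: B(5))
    note move = leaf_move_possible[OF t at leaf ab(3) this \<open>is_leaf t v'\<close> tree]
      leaf_move_in_Subtrees[OF t at leaf ab(3) this tree]
    have "is_subgraph (add_edge A a b) (add_edge B a b)"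
      using B(2) Ab by (auto simp: is_subgraph_def is_tree_def)
    then show ?thesis using move unfolding eq by blast
  next
    case cycle
    note u = at cycle(1) ab(3) cycle(2)
    obtain e where e: "e \<in> cycle_edges (created_cycle t a b)" "e \<notin> edges (add_edge A a b)"
      using cycle_leaves_tree[OF Ab created_cycle(1)[OF t u]] .
    have "is_subgraph (add_edge A a b) (remove_edge (add_edge t a b) e)"
      using A(2) Ab e(2) by (auto simp: is_subgraph_def is_tree_def)
    then show ?thesis
      using cycle_move_possible[OF t u e(1)] cycle_move_in_Subtrees[OF t u e(1)] by blast
  qed
qed

text \<open>Move along a walk of \<open>G\<close>, keeping a single vertex fixed in each step.\<close>
lemma reach_vertex:
  assumes t: "t \<in> Subtrees G n" and a: "a \<in> verts t" and b: "b \<in> verts G"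
  shows "\<exists>t'\<in>Subtrees G n. reachable (subtree_step G) t t' \<and> b \<in> verts t'"
proof -
  have "a \<in> verts G" using a SubtreesD(6)[OF t] by blast
  then have "(a, b) \<in> (adj G)\<^sup>*"
    using b connected_G by (simp add: connected_graph_iff[OF simple_G])
  then show ?thesis
  proof induction
    case base
    then show ?case using t a reachable_refl by metis
  next
    case (step y z)
    then obtain t' where t': "t' \<in> Subtrees G n" "reachable (subtree_step G) t t'" "y \<in> verts t'"
      by blast
    have yz: "{y, z} \<in> edges G" using step.hyps by simp
    have "y \<noteq> z" using simple_graph_edgeD(3)[OF simple_G yz] .
    then obtain t'' where "t'' \<in> Subtrees G n" "t'' \<in> set_pmf (subtree_step G t')"
      "is_subgraph (add_edge (UGraph {y} {}) y z) t''"
      using extend_common_subtree[OF t'(1) is_tree_single is_subgraph_single[OF t'(3)] _ _ _ yz]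
        two_le_n by auto
    moreover from this have "z \<in> verts t''" by (auto simp: is_subgraph_def)
    ultimately show ?case using reachable_trans[OF t'(2) reachable_step] by blast
  qed
qed

text \<open>Enlarge the common subtree by an edge of \<open>s\<close> that leaves it; once it has \<open>n\<close> vertices it spans,
  and so equals, both trees.\<close>
lemma reach_from_common_subtree:
  assumes "t \<in> Subtrees G n" "s \<in> Subtrees G n" "is_tree A" "is_subgraph A t" "is_subgraph A s"
  shows "reachable (subtree_step G) t s"
  using assms
proof (induction "n - card (verts A)" arbitrary: A t rule: less_induct)
  case less
  note t = less.prems(1) and s = less.prems(2) and A = less.prems(3-5)
  note T = SubtreesD[OF t] and S = SubtreesD[OF s]
  have sub: "verts A \<subseteq> verts t" "verts A \<subseteq> verts s" "verts A \<noteq> {}" "connected_graph A"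
    using A by (auto simp: is_subgraph_def is_tree_def connected_graph_def)
  show ?case
  proof (cases "card (verts A) = n")
    case True
    then have "verts A = verts t" "verts A = verts s"
      using sub T(3,5) S(3,5) by (simp_all add: card_subset_eq)
    then have "A = t" "A = s"
      using tree_spanning_subgraph_eq T(1) S(1) A(2,3) sub(4) by metis+
    then show ?thesis using reachable_refl by simp
  next
    case False
    then have less_n: "card (verts A) < n" using card_mono[OF T(3) sub(1)] T(5) by simp
    have "verts A \<noteq> verts s" using False S(5) by auto
    then obtain a b where ab: "a \<in> verts A" "b \<notin> verts A" "{a, b} \<in> edges s"
      using connected_exit_edge[OF S(2) _ sub(2,3)] S(1) unfolding is_tree_def by blast
    then have "{a, b} \<in> edges G" using S(7) by blast
    then obtain t' where t': "t' \<in> Subtrees G n" "t' \<in> set_pmf (subtree_step G t)"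
      "is_subgraph (add_edge A a b) t'"
      using extend_common_subtree[OF t A(1,2) less_n ab(1,2)] by blast
    have tree: "is_tree (add_edge A a b)" using is_tree_add_leaf[OF A(1) ab(1,2)] .
    have "simple_graph A" using A(1) by (simp add: is_tree_def)
    then have "card (verts (add_edge A a b)) = Suc (card (verts A))"
      using card_add_leaf(1)[OF finite_subset[OF sub(1) T(3)] _ ab(1,2)] by blast
    then have "n - card (verts (add_edge A a b)) < n - card (verts A)" using less_n by simp
    then have "reachable (subtree_step G) t' s"
      using less.hyps[OF _ t'(1) s tree t'(3) is_subgraph_add_edge[OF A(3) S(2) ab(3)]] by blast
    then show ?thesis using reachable_trans reachable_step t'(2) by metis
  qed
qed

lemma irreducible_Subtrees: "irreducible_chain (Subtrees G n) (subtree_step G)"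
  unfolding irreducible_chain_def
proof (intro ballI)
  fix t s assume t: "t \<in> Subtrees G n" and s: "s \<in> Subtrees G n"
  obtain a b where a: "a \<in> verts t" and b: "b \<in> verts s"
    using SubtreesD(4)[OF t] SubtreesD(4)[OF s] by blast
  then have "b \<in> verts G" using SubtreesD(6)[OF s] by blast
  then obtain t' where t': "t' \<in> Subtrees G n" "reachable (subtree_step G) t t'" "b \<in> verts t'"
    using reach_vertex[OF t a] by blast
  have "reachable (subtree_step G) t' s"
    using reach_from_common_subtree[OF t'(1) s is_tree_single is_subgraph_single[OF t'(3)]
        is_subgraph_single[OF b]] .
  then show "\<exists>k. pmf (n_step (subtree_step G) k t) s > 0"
    using reachable_trans[OF t'(2)] by (simp add: reachable_def)
qed

lemma Subtrees_nonempty: "Subtrees G n \<noteq> {}"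
proof -
  have "\<exists>A. is_tree A \<and> is_subgraph A G \<and> card (verts A) = k" if "1 \<le> k" "k \<le> n" for k
    using that
  proof (induction k rule: dec_induct)
    case base
    obtain v where "v \<in> verts G" using connected_G by (auto simp: connected_graph_def)
    then show ?case
      using is_tree_single is_subgraph_single by (intro exI[of _ "UGraph {v} {}"]) auto
  next
    case (step k)
    then obtain A where A: "is_tree A" "is_subgraph A G" "card (verts A) = k" by auto
    then have sub: "verts A \<subseteq> verts G" "verts A \<noteq> {}" "simple_graph A"
      by (auto simp: is_subgraph_def is_tree_def connected_graph_def)
    have "verts A \<noteq> verts G" using A(3) step n_le by auto
    then obtain a b where ab: "a \<in> verts A" "b \<notin> verts A" "{a, b} \<in> edges G"
      using connected_exit_edge[OF simple_G connected_G sub(1,2)] by blast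
    show ?case
      using is_tree_add_leaf[OF A(1) ab(1,2)] is_subgraph_add_edge[OF A(2) simple_G ab(3)]
        card_add_leaf(1)[OF finite_subset[OF sub(1) finite_G] sub(3) ab(1,2)] A(3) by metis
  qed
  from this[of n] obtain A where "is_tree A" "is_subgraph A G" "card (verts A) = n"
    using two_le_n by auto
  then have "A \<in> Subtrees G n" by (simp add: Subtrees_def)
  then show ?thesis by blast
qed

end

section \<open>The uniform distribution on subtrees\<close>

theorem mainTheorem2:
  fixes G :: "'a ugraph" and n :: nat
  assumes "finite (verts G)" and "simple_graph G" and "connected_graph G"
    and "2 \<le> n" and "n \<le> card (verts G)"
  shows "kernel_on (Subtrees G n) (subtree_step G) \<and>
    irreducible_chain (Subtrees G n) (subtree_step G) \<and>
    aperiodic_chain (Subtrees G n) (subtree_step G) \<and>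
    reversible_wrt (Subtrees G n) (subtree_step G) (pmf_of_set (Subtrees G n)) \<and>
    ergodic_chain (Subtrees G n) (subtree_step G) \<and>
    (\<forall>\<pi>. invariant_distribution (Subtrees G n) (subtree_step G) \<pi> \<longleftrightarrow>
         \<pi> = pmf_of_set (Subtrees G n))"
proof -
  interpret subtree_chain G n by unfold_locales (use assms in auto)
  let ?S = "Subtrees G n" and ?K = "subtree_step G" and ?U = "pmf_of_set (Subtrees G n)"
  have hold: "pmf (?K t) t > 0" if "t \<in> ?S" for t
    using stay_possible[OF that] by (simp add: pmf_positive_iff)
  note chain = finite_Subtrees Subtrees_nonempty kernel_on_Subtrees irreducible_Subtrees hold
  have rev: "reversible_wrt ?S ?K ?U"
    using finite_Subtrees Subtrees_nonempty subtree_step_sym by (simp add: reversible_wrt_def)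
  have "set_pmf ?U \<subseteq> ?S"
    using finite_Subtrees Subtrees_nonempty by (simp add: set_pmf_of_set)
  then have inv: "invariant_distribution ?S ?K ?U"
    using reversible_imp_invariant[OF finite_Subtrees kernel_on_Subtrees _ rev] by blast
  moreover have "\<pi> = ?U" if "invariant_distribution ?S ?K \<pi>" for \<pi>
    using invariant_unique[OF chain that inv] .
  moreover have "aperiodic_chain ?S ?K" using aperiodic_chainI[OF hold] .
  moreover have "ergodic_chain ?S ?K" using ergodic_chainI[OF chain inv] .
  ultimately show ?thesis
    using kernel_on_Subtrees irreducible_Subtrees rev by blast
qed

end
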